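(* (i) Let $T\subseteq\mathbb{N}^*$ be a computable finitely branching tree such that each node of $T$ has at least two successors in $T$, and let $S$ be a computable subtree of $T$ without leaves. For each $f\in[S]$, viewing $[S]$ as a subset of the metric space $([T],d)$, we have $$\mathit{dim}(f)\le\underline{\dim}_B([S])\qquad\text{and}\qquad \mathit{Dim}(f)\le\overline{\dim}_B([S]).$$ (ii) Suppose $S$ is level-wise uniformly branching. Then the equalities hold in (i) in the case that $f$ is Martin-Löf random in $[S]$ with respect to the uniform measure $\mu_S$.
   Context: Trees. $\mathbb{N}^*$ is the set of finite strings of natural numbers; a (sub)tree is a nonempty subset closed under initial segments; the successors of $\sigma$ in a tree are the strings in the tree obtained from $\sigma$ by appending one element; a leaf is a node with no successors. A tree is computable if it is a computable subset of $\mathbb{N}^*$. $T_n$ is the set of strings in $T$ of length $n$; $[T]$ is the set of infinite sequences $f$ with every initial segment $f\upharpoonright_n$ (of length $n$) in $T$. A tree $S$ is level-wise uniformly branching if for each $n$ all $\sigma\in S_n$ have the same number of successors in $S$. Metric. For distinct $f,g\in[T]$, $d(f,g)=1/|T_n|$ for the largest $n$ with $f\upharpoonright_n=g\upharpoonright_n$; $d(f,f)=0$. Box dimensions. For $X\subseteq[T]$, $N_\alpha(X)$ is the least cardinality of a covering of $X$ by sets of diameter at most $\alpha$, $\underline{\dim}_B(X)=\liminf_{\alpha\to0^+}\log N_\alpha(X)/\log(1/\alpha)$ and $\overline{\dim}_B(X)=\limsup_{\alpha\to0^+}\log N_\alpha(X)/\log(1/\alpha)$. Logarithms are in base 2. Algorithmic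 dimensions. Let $\underline r\colon\{0,1\}^*\to T$ be the computable bijection that is an isomorphism between the length-lexicographical orderings on $\{0,1\}^*$ and $T$. Fix $r\colon\{0,1\}^*\to[T]$ such that $r(u)$ is a path of $T$ extending $\underline r(u)$ and $r(u)$ is computable uniformly in $u$; let $D=\operatorname{range}(r)$ (a countable dense set). $C$ denotes plain Kolmogorov complexity of binary strings. For $w\in D$ let $C^{[T],r}(w)=\min\{C(u): r(u)=w\}$. For $x\in[T]$ and $\alpha>0$ let $C_\alpha(x)=\min\{C^{[T],r}(w): w\in D,\ d(x,w)\le\alpha\}$. The algorithmic dimension and strong algorithmic dimension of $x$ are $$\mathit{dim}(x)=\liminf_{\alpha\to0^+}\frac{C_\alpha(x)}{\log(1/\alpha)},\qquad \mathit{Dim}(x)=\limsup_{\alpha\to0^+}\frac{C_\alpha(x)}{\log(1/\alpha)}.$$ Randomness. For $\sigma\in S$ write $[\sigma]$ for the set of $f\in[S]$ extending $\sigma$. The uniform measure $\mu_S$ is the Borel probability measure on $[S]$ with $\mu_S([S])=1$ and $\mu_S([\tau])=\mu_S([\sigma])/k_\sigma$ for each successor $\tau\in S$ of $\sigma\in S$, where $k_\sigma$ is the number of successors of $\sigma$ in $S$. A Martin-Löf test on $[S]$ is a sequence $(G_m)_{m\in\mathbb{N}}$ of uniformly $\Sigma^0_1$ (effectively open) subsets of $[S]$ with $\mu_S(G_m)\le2^{-m}$; $f\in[S]$ is Martin-Löf random (with respect to $\mu_S$) if $f\notin\bigcap_mG_m$ for every Martin-Löf test. *)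

theory Defs
  imports "HOL-Probability.Probability" "HOL-Library.Sublist" "HOL-Library.Nat_Bijection"
begin

section \<open>Computability\<close>

datatype recf =
    Zero
  | Succ
  | Proj nat
  | Comp recf "recf list"
  | PrimRec recf recf
  | Mu recf

text \<open>
  \<open>rec_eval e xs y\<close>: the \<open>\<mu>\<close>-recursive program \<open>e\<close> halts on the arguments \<open>xs\<close> with value \<open>y\<close>.
  A primitive recursion runs over its first argument, and its step function receives the
  counter, the previous value and the parameters, in that order.
\<close>

inductive rec_eval :: "recf \<Rightarrow> nat list \<Rightarrow> nat \<Rightarrow> bool" where
  "rec_eval Zero xs 0"
| "rec_eval Succ [x] (Suc x)"
| "i < length xs \<Longrightarrow> rec_eval (Proj i) xs (xs ! i)"
| "list_all2 (\<lambda>g y. rec_eval g xs y) gs ys \<Longrightarrow> rec_eval f ys z \<Longrightarrow> rec_eval (Comp f gs) xs z"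
| "rec_eval f xs y \<Longrightarrow> rec_eval (PrimRec f g) (0 # xs) y"
| "rec_eval (PrimRec f g) (n # xs) y \<Longrightarrow> rec_eval g (n # y # xs) z \<Longrightarrow>
     rec_eval (PrimRec f g) (Suc n # xs) z"
| "rec_eval f (n # xs) 0 \<Longrightarrow> (\<forall>i<n. \<exists>y. rec_eval f (i # xs) (Suc y)) \<Longrightarrow> rec_eval (Mu f) xs n"

text \<open>Explicit effective codings by natural numbers. The class \<open>countable\<close> is of no use here, as
  its injections are not computable in general.\<close>

class encodable =
  fixes enc :: "'a \<Rightarrow> nat"
  assumes inj_enc: "inj enc"

instantiation nat :: encodable
begin
definition "enc (n::nat) = n"
instance by standard (simp add: enc_nat_def inj_def)
end

instantiation bool :: encodable
begin
definition "enc (b::bool) = (if b then 1 else 0::nat)"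
instance by standard (simp add: enc_bool_def inj_def)
end

instantiation prod :: (encodable, encodable) encodable
begin
definition "enc p = prod_encode (enc (fst p), enc (snd p))"
instance by standard (auto simp: enc_prod_def inj_def inj_eq[OF inj_enc])
end

instantiation list :: (encodable) encodable
begin
definition "enc xs = list_encode (map enc xs)"
instance
  by standard (auto simp: enc_list_def inj_def inj_map_eq_map[OF inj_enc] list_encode_eq)
end

definition partial_computable :: "('a::encodable \<rightharpoonup> 'b::encodable) \<Rightarrow> bool" where
  "partial_computable F \<longleftrightarrow>
     (\<exists>e. \<forall>a y. rec_eval e [enc a] y \<longleftrightarrow> (\<exists>b. F a = Some b \<and> y = enc b))"

definition computable :: "('a::encodable \<Rightarrow> 'b::encodable) \<Rightarrow> bool" where
  "computable f \<longleftrightarrow> partial_computable (\<lambda>a. Some (f a))"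

definition computable_set :: "'a::encodable set \<Rightarrow> bool" where
  "computable_set A \<longleftrightarrow> computable (\<lambda>a. a \<in> A)"

definition ce_set :: "'a::encodable set \<Rightarrow> bool" where
  "ce_set A \<longleftrightarrow> (\<exists>F :: 'a \<rightharpoonup> nat. partial_computable F \<and> A = dom F)"


section \<open>Plain Kolmogorov complexity\<close>

text \<open>A machine is a partial computable function on binary strings. Plain complexity is taken
  with respect to an (arbitrary) optimal machine \<open>U\<close>.\<close>

definition optimal_machine :: "(bool list \<rightharpoonup> bool list) \<Rightarrow> bool" where
  "optimal_machine U \<longleftrightarrow> partial_computable U \<and>
     (\<forall>V :: bool list \<rightharpoonup> bool list. partial_computable V \<longrightarrow>
        (\<exists>c. \<forall>p u. V p = Some u \<longrightarrow> (\<exists>q. U q = Some u \<and> length q \<le> length p + c)))"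

definition plain_complexity :: "(bool list \<rightharpoonup> bool list) \<Rightarrow> bool list \<Rightarrow> nat" where
  "plain_complexity U u = (LEAST k. \<exists>p. U p = Some u \<and> length p = k)"


section \<open>Trees\<close>

definition is_tree :: "nat list set \<Rightarrow> bool" where
  "is_tree T \<longleftrightarrow> T \<noteq> {} \<and> (\<forall>\<tau>\<in>T. \<forall>\<sigma>. prefix \<sigma> \<tau> \<longrightarrow> \<sigma> \<in> T)"

definition successors :: "nat list set \<Rightarrow> nat list \<Rightarrow> nat list set" where
  "successors T \<sigma> = {\<tau> \<in> T. \<exists>k. \<tau> = \<sigma> @ [k]}"

definition leaf :: "nat list set \<Rightarrow> nat list \<Rightarrow> bool" where
  "leaf T \<sigma> \<longleftrightarrow> \<sigma> \<in> T \<and> successors T \<sigma> = {}"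

definition finitely_branching :: "nat list set \<Rightarrow> bool" where
  "finitely_branching T \<longleftrightarrow> (\<forall>\<sigma>\<in>T. finite (successors T \<sigma>))"

definition level :: "nat list set \<Rightarrow> nat \<Rightarrow> nat list set" where
  "level T n = {\<sigma> \<in> T. length \<sigma> = n}"

definition levelwise_uniformly_branching :: "nat list set \<Rightarrow> bool" where
  "levelwise_uniformly_branching S \<longleftrightarrow>
     (\<forall>n. \<forall>\<sigma>\<in>level S n. \<forall>\<tau>\<in>level S n. card (successors S \<sigma>) = card (successors S \<tau>))"

definition restr :: "(nat \<Rightarrow> nat) \<Rightarrow> nat \<Rightarrow> nat list" where
  "restr f n = map f [0..<n]"

definition paths :: "nat list set \<Rightarrow> (nat \<Rightarrow> nat) set" where
  "paths T = {f. \<forall>n. restr f n \<in> T}"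

definition cylinder :: "nat list set \<Rightarrow> nat list \<Rightarrow> (nat \<Rightarrow> nat) set" where
  "cylinder S \<sigma> = {f \<in> paths S. restr f (length \<sigma>) = \<sigma>}"

definition tree_dist :: "nat list set \<Rightarrow> (nat \<Rightarrow> nat) \<Rightarrow> (nat \<Rightarrow> nat) \<Rightarrow> real" where
  "tree_dist T f g =
     (if f = g then 0 else 1 / real (card (level T (GREATEST n. restr f n = restr g n))))"


section \<open>Box dimensions in a metric space with carrier \<open>M\<close> and metric \<open>d\<close>\<close>

definition diam :: "('a \<Rightarrow> 'a \<Rightarrow> real) \<Rightarrow> 'a set \<Rightarrow> real" where
  "diam d A = (if A = {} then 0 else SUP (x, y)\<in>A \<times> A. d x y)"

definition covering_number :: "'a set \<Rightarrow> ('a \<Rightarrow> 'a \<Rightarrow> real) \<Rightarrow> real \<Rightarrow> 'a set \<Rightarrow> nat" where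
  "covering_number M d \<alpha> X =
     (LEAST k. \<exists>\<A>. finite \<A> \<and> card \<A> = k \<and> X \<subseteq> \<Union>\<A> \<and> (\<forall>A\<in>\<A>. A \<subseteq> M \<and> diam d A \<le> \<alpha>))"

text \<open>The limits are extended reals, as they may be infinite in a space \<open>[T]\<close> if the levels
  of \<open>T\<close> grow fast.\<close>

definition lower_box_dim :: "'a set \<Rightarrow> ('a \<Rightarrow> 'a \<Rightarrow> real) \<Rightarrow> 'a set \<Rightarrow> ereal" where
  "lower_box_dim M d X =
     Liminf (at_right 0) (\<lambda>\<alpha>. ereal (log 2 (real (covering_number M d \<alpha> X)) / log 2 (1 / \<alpha>)))"

definition upper_box_dim :: "'a set \<Rightarrow> ('a \<Rightarrow> 'a \<Rightarrow> real) \<Rightarrow> 'a set \<Rightarrow> ereal" where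
  "upper_box_dim M d X =
     Limsup (at_right 0) (\<lambda>\<alpha>. ereal (log 2 (real (covering_number M d \<alpha> X)) / log 2 (1 / \<alpha>)))"


section \<open>Algorithmic dimensions\<close>

definition lenlex_iso :: "(bool list \<Rightarrow> nat list) \<Rightarrow> nat list set \<Rightarrow> bool" where
  "lenlex_iso h T \<longleftrightarrow> bij_betw h UNIV T \<and>
     (\<forall>u v. (u, v) \<in> lenlex {(x, y). x < y} \<longleftrightarrow> (h u, h v) \<in> lenlex {(x, y). x < y})"

text \<open>\<open>h\<close> is the length-lexicographical isomorphism \<open>{0,1}* \<rightarrow> T\<close>; the last conjunct says that \<open>r u\<close> is a computable
  sequence uniformly in \<open>u\<close>.\<close>

definition path_representation ::
    "nat list set \<Rightarrow> (bool list \<Rightarrow> nat list) \<Rightarrow> (bool list \<Rightarrow> nat \<Rightarrow> nat) \<Rightarrow> bool" where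
  "path_representation T h r \<longleftrightarrow>
     (\<forall>u. r u \<in> paths T \<and> restr (r u) (length (h u)) = h u) \<and>
     computable (\<lambda>(u, n). r u n)"

definition point_complexity ::
    "(bool list \<rightharpoonup> bool list) \<Rightarrow> (bool list \<Rightarrow> 'a) \<Rightarrow> 'a \<Rightarrow> nat" where
  "point_complexity U r w = (LEAST k. \<exists>u. r u = w \<and> plain_complexity U u = k)"

definition approx_complexity ::
    "(bool list \<rightharpoonup> bool list) \<Rightarrow> ('a \<Rightarrow> 'a \<Rightarrow> real) \<Rightarrow> (bool list \<Rightarrow> 'a) \<Rightarrow> real \<Rightarrow> 'a \<Rightarrow> nat" where
  "approx_complexity U d r \<alpha> x =
     (LEAST k. \<exists>w\<in>range r. d x w \<le> \<alpha> \<and> point_complexity U r w = k)"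

definition alg_dim ::
    "(bool list \<rightharpoonup> bool list) \<Rightarrow> ('a \<Rightarrow> 'a \<Rightarrow> real) \<Rightarrow> (bool list \<Rightarrow> 'a) \<Rightarrow> 'a \<Rightarrow> ereal" where
  "alg_dim U d r x =
     Liminf (at_right 0) (\<lambda>\<alpha>. ereal (real (approx_complexity U d r \<alpha> x) / log 2 (1 / \<alpha>)))"

definition strong_alg_dim ::
    "(bool list \<rightharpoonup> bool list) \<Rightarrow> ('a \<Rightarrow> 'a \<Rightarrow> real) \<Rightarrow> (bool list \<Rightarrow> 'a) \<Rightarrow> 'a \<Rightarrow> ereal" where
  "strong_alg_dim U d r x =
     Limsup (at_right 0) (\<lambda>\<alpha>. ereal (real (approx_complexity U d r \<alpha> x) / log 2 (1 / \<alpha>)))"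


section \<open>Randomness\<close>

text \<open>The Borel sets of \<open>[S]\<close> are those of the product topology on \<open>nat \<Rightarrow> nat\<close>, \<open>nat\<close> being
  discrete; the cylinders form a base of this topology on \<open>[S]\<close>.\<close>

definition uniform_tree_measure :: "nat list set \<Rightarrow> (nat \<Rightarrow> nat) measure \<Rightarrow> bool" where
  "uniform_tree_measure S \<mu> \<longleftrightarrow>
     prob_space \<mu> \<and> sets \<mu> = sets (restrict_space borel (paths S)) \<and>
     (\<forall>\<sigma>\<in>S. \<forall>\<tau>\<in>successors S \<sigma>.
        measure \<mu> (cylinder S \<tau>) = measure \<mu> (cylinder S \<sigma>) / real (card (successors S \<sigma>)))"

definition uniformly_Sigma1 :: "nat list set \<Rightarrow> (nat \<Rightarrow> (nat \<Rightarrow> nat) set) \<Rightarrow> bool" where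
  "uniformly_Sigma1 S G \<longleftrightarrow>
     (\<exists>W :: (nat \<times> nat list) set. ce_set W \<and> (\<forall>m. G m = (\<Union>\<sigma>\<in>{\<sigma>. (m, \<sigma>) \<in> W}. cylinder S \<sigma>)))"

definition ml_test :: "nat list set \<Rightarrow> (nat \<Rightarrow> nat) measure \<Rightarrow> (nat \<Rightarrow> (nat \<Rightarrow> nat) set) \<Rightarrow> bool" where
  "ml_test S \<mu> G \<longleftrightarrow> uniformly_Sigma1 S G \<and> (\<forall>m. measure \<mu> (G m) \<le> 1 / 2 ^ m)"

definition ml_random :: "nat list set \<Rightarrow> (nat \<Rightarrow> nat) measure \<Rightarrow> (nat \<Rightarrow> nat) \<Rightarrow> bool" where
  "ml_random S \<mu> f \<longleftrightarrow> f \<in> paths S \<and> (\<forall>G. ml_test S \<mu> G \<longrightarrow> f \<notin> (\<Inter>m. G m))"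

end

theory Submission
  imports Defs "HOL-Real_Asymp.Real_Asymp"
begin

text \<open>
  Both dimension quotients have the same denominator \<open>log (1/\<alpha>)\<close>, so it suffices to compare numerators
  up to \<open>o(log (1/\<alpha>))\<close>. Let \<open>n\<close> be least with \<open>1/|T\<^sub>n| \<le> \<alpha>\<close>. Closed balls of radius \<open>\<alpha>\<close> are cylinders of
  nodes of length \<open>n\<close>, so that the covering number of \<open>[S]\<close> is \<open>|S\<^sub>n|\<close>, while the complexity at scale
  \<open>\<alpha>\<close> of a path \<open>f\<close> is the least complexity of a string \<open>u\<close> such that \<open>r u\<close> agrees with \<open>f\<close> up to \<open>n\<close>; and
  \<open>n \<le> 1 + log (1/\<alpha>)\<close>, since \<open>|T\<^sub>n| \<ge> 2\<^sup>n\<close>. So errors \<open>O(log n)\<close> are harmless.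

  Upper bound: in the listing of the nodes of \<open>S\<close> in length-lexicographical order, a node of length \<open>n\<close> has an
  index less than \<open>(n + 1) |S\<^sub>n|\<close>, hence complexity at most \<open>log |S\<^sub>n| + log (n + 1) + O(1)\<close>.

  Lower bound: if \<open>S\<close> is level-wise uniformly branching, each node in \<open>S\<^sub>n\<close> has measure \<open>1/|S\<^sub>n|\<close>. Hence
  the nodes of length \<open>n\<close> described by one of the first \<open>|S\<^sub>n| / ((n + 1) (n + 2) 2\<^sup>m)\<close> programs have total measure
  at most \<open>2\<^sup>-\<^sup>m / ((n + 1) (n + 2))\<close>. The sum over \<open>n\<close> is \<open>2\<^sup>-\<^sup>m\<close>, so these nodes form a Martin-Loef test, and a
  random \<open>f\<close> satisfies \<open>log |S\<^sub>n| \<le> C(u) + O(log n)\<close> for each \<open>u\<close> as above. The test is effective as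
  partial computable functions can be evaluated in stages.
\<close>

section \<open>Recursive functions on argument lists\<close>

lemma rec_eval_Zero_iff: "rec_eval Zero xs y \<longleftrightarrow> y = 0"
  by (subst rec_eval.simps) auto

lemma rec_eval_Succ_iff: "rec_eval Succ xs y \<longleftrightarrow> (\<exists>x. xs = [x] \<and> y = Suc x)"
  by (subst rec_eval.simps) auto

lemma rec_eval_Proj_iff: "rec_eval (Proj i) xs y \<longleftrightarrow> i < length xs \<and> y = xs ! i"
  by (subst rec_eval.simps) auto

lemma rec_eval_Comp_iff:
  "rec_eval (Comp f gs) xs z \<longleftrightarrow>
     (\<exists>ys. list_all2 (\<lambda>g y. rec_eval g xs y) gs ys \<and> rec_eval f ys z)"
  by (subst rec_eval.simps) auto

lemma rec_eval_PrimRec_0_iff: "rec_eval (PrimRec f g) (0 # xs) y \<longleftrightarrow> rec_eval f xs y"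
  by (subst rec_eval.simps) auto

lemma rec_eval_PrimRec_Suc_iff:
  "rec_eval (PrimRec f g) (Suc n # xs) z \<longleftrightarrow>
     (\<exists>y. rec_eval (PrimRec f g) (n # xs) y \<and> rec_eval g (n # y # xs) z)"
  by (subst rec_eval.simps) auto

lemma rec_eval_Mu_iff:
  "rec_eval (Mu f) xs n \<longleftrightarrow>
     rec_eval f (n # xs) 0 \<and> (\<forall>i<n. \<exists>y. rec_eval f (i # xs) (Suc y))"
  by (subst rec_eval.simps) auto

text \<open>Only lists of length \<open>n\<close> are constrained, so a program may diverge or
  return anything on other lists. The equivalence expresses halting and uniqueness of the value at
  once.\<close>

definition computes :: "nat \<Rightarrow> recf \<Rightarrow> (nat list \<Rightarrow> nat) \<Rightarrow> bool" where
  "computes n e F \<longleftrightarrow> (\<forall>xs y. length xs = n \<longrightarrow> (rec_eval e xs y \<longleftrightarrow> y = F xs))"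

definition recursive :: "nat \<Rightarrow> (nat list \<Rightarrow> nat) \<Rightarrow> bool" where
  "recursive n F \<longleftrightarrow> (\<exists>e. computes n e F)"

lemma recursive_cong:
  assumes "recursive n F" "\<And>xs. length xs = n \<Longrightarrow> F xs = G xs"
  shows "recursive n G"
  using assms unfolding recursive_def computes_def by metis

lemma recursive_proj: "i < n \<Longrightarrow> recursive n (\<lambda>xs. xs ! i)"
  unfolding recursive_def computes_def
  by (rule exI[of _ "Proj i"]) (auto simp: rec_eval_Proj_iff)

lemma recursive_zero: "recursive n (\<lambda>_. 0)"
  unfolding recursive_def computes_def
  by (rule exI[of _ Zero]) (auto simp: rec_eval_Zero_iff)

lemma recursive_comp1:
  assumes "recursive 1 (\<lambda>xs. f (xs ! 0))" "recursive n A"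
  shows "recursive n (\<lambda>xs. f (A xs))"
proof -
  obtain e a where "computes 1 e (\<lambda>xs. f (xs ! 0))" "computes n a A"
    using assms unfolding recursive_def by auto
  then have "computes n (Comp e [a]) (\<lambda>xs. f (A xs))"
    by (auto simp: computes_def rec_eval_Comp_iff list_all2_Cons1)
  then show ?thesis unfolding recursive_def by blast
qed

lemma recursive_comp2:
  assumes "recursive 2 (\<lambda>xs. f (xs ! 0) (xs ! 1))" "recursive n A" "recursive n B"
  shows "recursive n (\<lambda>xs. f (A xs) (B xs))"
proof -
  obtain e a b where "computes 2 e (\<lambda>xs. f (xs ! 0) (xs ! 1))" "computes n a A" "computes n b B"
    using assms unfolding recursive_def by auto
  then have "computes n (Comp e [a, b]) (\<lambda>xs. f (A xs) (B xs))"
    by (auto simp: computes_def rec_eval_Comp_iff list_all2_Cons1)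
  then show ?thesis unfolding recursive_def by blast
qed

lemma recursive_Suc:
  assumes "recursive n A" shows "recursive n (\<lambda>xs. Suc (A xs))"
proof (rule recursive_comp1[OF _ assms])
  show "recursive 1 (\<lambda>xs. Suc (xs ! 0))"
    unfolding recursive_def computes_def
    by (rule exI[of _ Succ]) (auto simp: rec_eval_Succ_iff length_Suc_conv)
qed

lemma rec_eval_PrimRec:
  assumes "\<And>y. rec_eval f xs y \<longleftrightarrow> y = b" "\<And>k z y. rec_eval g (k # z # xs) y \<longleftrightarrow> y = s k z"
  shows "rec_eval (PrimRec f g) (m # xs) y \<longleftrightarrow> y = rec_nat b s m"
  by (induction m arbitrary: y)
     (auto simp: rec_eval_PrimRec_0_iff rec_eval_PrimRec_Suc_iff assms)

lemma recursive_primrec1: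
  assumes "recursive 2 (\<lambda>xs. g (xs ! 0) (xs ! 1))"
  shows "recursive 1 (\<lambda>xs. rec_nat 0 g (xs ! 0))"
proof -
  obtain e where e: "computes 2 e (\<lambda>xs. g (xs ! 0) (xs ! 1))"
    using assms unfolding recursive_def by auto
  have "computes 1 (PrimRec Zero e) (\<lambda>xs. rec_nat 0 g (xs ! 0))"
    unfolding computes_def
  proof (intro allI impI)
    fix xs :: "nat list" and y assume "length xs = 1"
    then obtain m where [simp]: "xs = [m]" by (auto simp: length_Suc_conv)
    show "rec_eval (PrimRec Zero e) xs y \<longleftrightarrow> y = rec_nat 0 g (xs ! 0)"
      using rec_eval_PrimRec[of Zero "[]" 0 e g m y] e
      by (auto simp: rec_eval_Zero_iff computes_def)
  qed
  then show ?thesis unfolding recursive_def by blast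
qed

lemma recursive_primrec2:
  assumes "recursive 1 (\<lambda>xs. b (xs ! 0))" "recursive 3 (\<lambda>xs. g (xs ! 2) (xs ! 0) (xs ! 1))"
  shows "recursive 2 (\<lambda>xs. rec_nat (b (xs ! 1)) (g (xs ! 1)) (xs ! 0))"
proof -
  obtain e f where e: "computes 3 e (\<lambda>xs. g (xs ! 2) (xs ! 0) (xs ! 1))"
    and f: "computes 1 f (\<lambda>xs. b (xs ! 0))"
    using assms unfolding recursive_def by auto
  have "computes 2 (PrimRec f e) (\<lambda>xs. rec_nat (b (xs ! 1)) (g (xs ! 1)) (xs ! 0))"
    unfolding computes_def
  proof (intro allI impI)
    fix xs :: "nat list" and y assume "length xs = 2"
    then obtain m x where [simp]: "xs = [m, x]" by (auto simp: length_Suc_conv numeral_2_eq_2)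
    show "rec_eval (PrimRec f e) xs y \<longleftrightarrow> y = rec_nat (b (xs ! 1)) (g (xs ! 1)) (xs ! 0)"
      using rec_eval_PrimRec[of f "[x]" "b x" e "g x" m y] e f
      by (auto simp: computes_def)
  qed
  then show ?thesis unfolding recursive_def by blast
qed

lemma recursive_add:
  assumes "recursive n A" "recursive n B" shows "recursive n (\<lambda>xs. A xs + B xs)"
proof (rule recursive_comp2[OF _ assms])
  have "recursive 2 (\<lambda>xs. rec_nat (xs ! 1) (\<lambda>k y. Suc y) (xs ! 0))"
    using recursive_primrec2[of "\<lambda>x. x" "\<lambda>x k y. Suc y"] recursive_proj recursive_Suc by simp
  moreover have "rec_nat b (\<lambda>k y. Suc y) a = a + b" for a b :: nat by (induction a) auto
  ultimately show "recursive 2 (\<lambda>xs. xs ! 0 + xs ! 1)" by simp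
qed

lemma recursive_diff:
  assumes "recursive n A" "recursive n B" shows "recursive n (\<lambda>xs. A xs - B xs)"
proof -
  \<comment> \<open>The predecessor is the primitive recursion that returns its counter, and
    truncated subtraction iterates it. As recursion runs over the first argument, the subtrahend
    comes first and the arguments are swapped at the end.\<close>
  have "recursive 1 (\<lambda>xs. rec_nat 0 (\<lambda>k y. k) (xs ! 0))"
    by (rule recursive_primrec1) (simp add: recursive_proj)
  moreover have "rec_nat 0 (\<lambda>k y. k) a = a - 1" for a :: nat by (cases a) auto
  ultimately have pred: "recursive 1 (\<lambda>xs. xs ! 0 - 1)" by simp
  have "recursive 3 (\<lambda>xs. xs ! 1 - 1)"
    by (rule recursive_comp1[OF pred]) (simp add: recursive_proj)
  then have "recursive 2 (\<lambda>xs. rec_nat (xs ! 1) (\<lambda>k y. y - 1) (xs ! 0))"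
    using recursive_primrec2[of "\<lambda>x. x" "\<lambda>x k y. y - 1"] recursive_proj by simp
  moreover have "rec_nat b (\<lambda>k y. y - 1) a = b - a" for a b :: nat by (induction a) auto
  ultimately have "recursive 2 (\<lambda>xs. xs ! 1 - xs ! 0)" by simp
  from recursive_comp2[of "\<lambda>a b. b - a", OF this assms(2,1)] show ?thesis by simp
qed

lemma recursive_triangle:
  assumes "recursive n A" shows "recursive n (\<lambda>xs. triangle (A xs))"
proof (rule recursive_comp1[OF _ assms])
  have "recursive 1 (\<lambda>xs. rec_nat 0 (\<lambda>k y. y + Suc k) (xs ! 0))"
    by (rule recursive_primrec1) (intro recursive_add recursive_Suc recursive_proj; simp)
  moreover have "rec_nat 0 (\<lambda>k y. y + Suc k) a = triangle a" for a :: nat by (induction a) auto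
  ultimately show "recursive 1 (\<lambda>xs. triangle (xs ! 0))" by simp
qed

lemma recursive_prod_encode:
  assumes "recursive n A" "recursive n B" shows "recursive n (\<lambda>xs. prod_encode (A xs, B xs))"
  unfolding prod_encode_def split by (intro recursive_add recursive_triangle assms)

text \<open>A recursion whose step is constantly 0 keeps its base value if the counter is 0 and
  yields 0 otherwise. The counters \<open>A - B\<close> and \<open>Suc B - A\<close> vanish in
  complementary cases, so exactly one branch survives in the sum.\<close>

lemma recursive_if_le:
  assumes "recursive n A" "recursive n B" "recursive n C" "recursive n D"
  shows "recursive n (\<lambda>xs. if A xs \<le> B xs then C xs else D xs)"
proof -
  have 1: "recursive 2 (\<lambda>xs. rec_nat (xs ! 1) (\<lambda>_ _. 0) (xs ! 0))"
    using recursive_primrec2[of "\<lambda>x. x" "\<lambda>x k y. 0"] recursive_proj recursive_zero by simp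
  have mask: "recursive n (\<lambda>xs. rec_nat (F xs) (\<lambda>_ _. 0) (G xs))"
    if "recursive n F" "recursive n G" for F G
    using recursive_comp2[of "\<lambda>a b. rec_nat b (\<lambda>_ _. 0) a", OF 1 that(2,1)] by simp
  have mask_eq: "rec_nat c (\<lambda>_ _. 0) k = (if k = 0 then c else 0)" for c k :: nat by (cases k) auto
  have "recursive n (\<lambda>xs. rec_nat (C xs) (\<lambda>_ _. 0) (A xs - B xs)
                          + rec_nat (D xs) (\<lambda>_ _. 0) (Suc (B xs) - A xs))"
    by (intro recursive_add mask recursive_diff recursive_Suc assms)
  then show ?thesis
    by (rule recursive_cong) (auto simp: mask_eq)
qed

text \<open>The diagonal \<open>fst p + snd p\<close> of \<open>p = prod_decode z\<close>.\<close>

definition diagonal :: "nat \<Rightarrow> nat" where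
  "diagonal = rec_nat 0 (\<lambda>z s. if triangle (Suc s) \<le> Suc z then Suc s else s)"

lemma triangle_strict_mono: "a < b \<Longrightarrow> triangle a < triangle b"
proof (induction b)
  case (Suc b)
  then have "triangle a \<le> triangle b" by (cases "a = b") auto
  then show ?case by simp
qed simp

text \<open>Consecutive triangular numbers above 0 differ by more than 1, so passing from
  \<open>z\<close> to \<open>z + 1\<close> crosses at most one of them, and the recursion step of
  \<open>diagonal\<close> reacts exactly then.\<close>

lemma triangle_bracket_diagonal: "triangle (diagonal z) \<le> z \<and> z < triangle (Suc (diagonal z))"
  by (induction z) (auto simp: diagonal_def)

text \<open>The intervals between consecutive triangular numbers are disjoint, and the code
  \<open>triangle (a + b) + a\<close> lies in the one with index \<open>a + b\<close>.\<close>

lemma diagonal_eq: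
  assumes "prod_decode z = (a, b)" shows "diagonal z = a + b"
proof -
  from assms have "z = prod_encode (a, b)"
    by (metis prod_decode_inverse)
  then have "z = triangle (a + b) + a"
    by (simp add: prod_encode_def)
  then have z: "triangle (a + b) \<le> z" "z < triangle (Suc (a + b))" by simp_all
  have "\<not> diagonal z < a + b"
  proof
    assume "diagonal z < a + b"
    then have "Suc (diagonal z) \<le> a + b" by simp
    then have "triangle (Suc (diagonal z)) \<le> triangle (a + b)"
      using triangle_strict_mono[of "Suc (diagonal z)" "a + b"] by (metis le_eq_less_or_eq)
    then show False using z triangle_bracket_diagonal[of z] by linarith
  qed
  moreover have "\<not> a + b < diagonal z"
  proof
    assume "a + b < diagonal z"
    then have "Suc (a + b) \<le> diagonal z" by simp
    then have "triangle (Suc (a + b)) \<le> triangle (diagonal z)"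
      using triangle_strict_mono[of "Suc (a + b)" "diagonal z"] by (metis le_eq_less_or_eq)
    then show False using z triangle_bracket_diagonal[of z] by linarith
  qed
  ultimately show ?thesis by simp
qed

lemma prod_decode_diagonal:
  "fst (prod_decode z) = z - triangle (diagonal z)"
  "snd (prod_decode z) = diagonal z - (z - triangle (diagonal z))"
proof -
  obtain a b where ab: "prod_decode z = (a, b)" by fastforce
  then have "z = prod_encode (a, b)"
    by (metis prod_decode_inverse)
  then have "z = triangle (a + b) + a"
    by (simp add: prod_encode_def)
  then show "fst (prod_decode z) = z - triangle (diagonal z)"
    "snd (prod_decode z) = diagonal z - (z - triangle (diagonal z))"
    using diagonal_eq[OF ab] ab by auto
qed

lemma recursive_prod_decode:
  assumes "recursive n A"
  shows "recursive n (\<lambda>xs. fst (prod_decode (A xs)))" "recursive n (\<lambda>xs. snd (prod_decode (A xs)))"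
proof -
  have "recursive 1 (\<lambda>xs. diagonal (xs ! 0))"
    unfolding diagonal_def
    by (rule recursive_primrec1)
       (intro recursive_if_le recursive_triangle recursive_Suc recursive_proj; simp)
  from recursive_comp1[OF this assms] have "recursive n (\<lambda>xs. diagonal (A xs))" .
  then show "recursive n (\<lambda>xs. fst (prod_decode (A xs)))"
    "recursive n (\<lambda>xs. snd (prod_decode (A xs)))"
    unfolding prod_decode_diagonal by (intro recursive_diff recursive_triangle assms; assumption)+
qed


section \<open>Closure properties of computable functions\<close>

lemma computable_iff:
  "computable f \<longleftrightarrow> (\<exists>e. \<forall>a y. rec_eval e [enc a] y \<longleftrightarrow> y = enc (f a))"
  unfolding computable_def partial_computable_def by auto

text \<open>Numbers are their own codes. Together with \<open>computable_same_code\<close> this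
  reduces operations on structured data to arithmetic on codes.\<close>

lemma computable_enc_iff: "computable (\<lambda>x. enc (f x)) \<longleftrightarrow> computable f"
  unfolding computable_iff by (simp add: enc_nat_def)

lemma computable_same_code:
  "computable f \<Longrightarrow> (\<And>x. enc (f x) = enc (g x)) \<Longrightarrow> computable g"
  unfolding computable_iff by simp

lemma computable_compose:
  assumes "computable f" "computable g" shows "computable (\<lambda>x. f (g x))"
proof -
  obtain d e where "\<And>a y. rec_eval d [enc a] y \<longleftrightarrow> y = enc (f a)"
    "\<And>a y. rec_eval e [enc a] y \<longleftrightarrow> y = enc (g a)"
    using assms unfolding computable_iff by auto
  then show ?thesis
    unfolding computable_iff
    by (intro exI[of _ "Comp d [e]"]) (auto simp: rec_eval_Comp_iff list_all2_Cons1)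
qed

lemma computable_id: "computable (\<lambda>x. x)"
  unfolding computable_iff by (intro exI[of _ "Proj 0"]) (auto simp: rec_eval_Proj_iff)

lemma computable_const: "computable (\<lambda>_. c)"
proof -
  have "\<exists>e. \<forall>xs y. rec_eval e xs y \<longleftrightarrow> y = n" for n
  proof (induction n)
    case 0 then show ?case by (intro exI[of _ Zero]) (auto simp: rec_eval_Zero_iff)
  next
    case (Suc n)
    then obtain e where "\<And>xs y. rec_eval e xs y \<longleftrightarrow> y = n" by auto
    then show ?case
      by (intro exI[of _ "Comp Succ [e]"])
         (auto simp: rec_eval_Comp_iff list_all2_Cons1 rec_eval_Succ_iff)
  qed
  then obtain e where "\<And>xs y. rec_eval e xs y \<longleftrightarrow> y = enc c" by metis
  then show ?thesis unfolding computable_iff by (intro exI[of _ e]) simp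
qed

lemma recursive_computable1:
  fixes f :: "nat \<Rightarrow> nat"
  assumes "recursive 1 (\<lambda>xs. f (xs ! 0))" "computable a"
  shows "computable (\<lambda>x. f (a x))"
proof (rule computable_compose[of f])
  obtain e where "computes 1 e (\<lambda>xs. f (xs ! 0))" using assms unfolding recursive_def by auto
  then have "\<And>a y. rec_eval e [a] y \<longleftrightarrow> y = f a" unfolding computes_def by auto
  then show "computable f" unfolding computable_iff enc_nat_def by blast
qed (fact assms(2))

lemma recursive_computable2:
  fixes f :: "nat \<Rightarrow> nat \<Rightarrow> nat"
  assumes "recursive 2 (\<lambda>xs. f (xs ! 0) (xs ! 1))" "computable a" "computable b"
  shows "computable (\<lambda>x. f (a x) (b x))"
proof -
  obtain e p q where "computes 2 e (\<lambda>xs. f (xs ! 0) (xs ! 1))"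
    "\<And>x y. rec_eval p [enc x] y \<longleftrightarrow> y = a x" "\<And>x y. rec_eval q [enc x] y \<longleftrightarrow> y = b x"
    using assms unfolding recursive_def computable_iff by (auto simp: enc_nat_def)
  then have "rec_eval (Comp e [p, q]) [enc x] y \<longleftrightarrow> y = f (a x) (b x)" for x y
    by (auto simp: rec_eval_Comp_iff list_all2_Cons1 computes_def)
  then show ?thesis unfolding computable_iff enc_nat_def by auto
qed

lemma computable_fst:
  fixes p :: "_ \<Rightarrow> 'a::encodable \<times> 'b::encodable"
  assumes "computable p" shows "computable (\<lambda>x. fst (p x))"
proof -
  have "computable (\<lambda>x. enc (p x))" using assms by (simp only: computable_enc_iff)
  then have "computable (\<lambda>x. fst (prod_decode (enc (p x))))"
    by (rule recursive_computable1[of "\<lambda>z. fst (prod_decode z)", rotated])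
       (intro recursive_prod_decode recursive_proj zero_less_one)
  then show ?thesis
    by (rule computable_same_code) (simp add: enc_prod_def enc_nat_def)
qed

lemma computable_snd:
  fixes p :: "_ \<Rightarrow> 'a::encodable \<times> 'b::encodable"
  assumes "computable p" shows "computable (\<lambda>x. snd (p x))"
proof -
  have "computable (\<lambda>x. enc (p x))" using assms by (simp only: computable_enc_iff)
  then have "computable (\<lambda>x. snd (prod_decode (enc (p x))))"
    by (rule recursive_computable1[of "\<lambda>z. snd (prod_decode z)", rotated])
       (intro recursive_prod_decode recursive_proj zero_less_one)
  then show ?thesis
    by (rule computable_same_code) (simp add: enc_prod_def enc_nat_def)
qed

lemma computable_Pair:
  assumes "computable a" "computable b" shows "computable (\<lambda>x. (a x, b x))"
proof -
  have "recursive 2 (\<lambda>xs. prod_encode (xs ! 0, xs ! 1))"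
    by (intro recursive_prod_encode recursive_proj) simp_all
  moreover have "computable (\<lambda>x. enc (a x))" "computable (\<lambda>x. enc (b x))"
    using assms by (simp_all only: computable_enc_iff)
  ultimately have "computable (\<lambda>x. prod_encode (enc (a x), enc (b x)))"
    by (rule recursive_computable2)
  then show ?thesis by (rule computable_same_code) (simp add: enc_prod_def enc_nat_def)
qed

lemma computable_compose2:
  assumes "computable (\<lambda>(x, y). f x y)" "computable a" "computable b"
  shows "computable (\<lambda>x. f (a x) (b x))"
  using computable_compose[OF assms(1) computable_Pair[OF assms(2,3)]] by simp

text \<open>Computability is stated for programs with one argument, whereas the step of a
  \<open>PrimRec\<close> receives counter, value and parameter separately. The program
  \<open>t\<close> packs these three into the nested pair that the program for \<open>g\<close>
  expects.\<close>

lemma computable_rec_nat: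
  assumes "computable b" "computable (\<lambda>p. g (fst p) (fst (snd p)) (snd (snd p)))" "computable a"
  shows "computable (\<lambda>x. rec_nat (b x) (g x) (a x))"
proof -
  obtain eb eg ea where e: "\<And>x y. rec_eval eb [enc x] y \<longleftrightarrow> y = enc (b x)"
    "\<And>x k z y. rec_eval eg [prod_encode (enc x, prod_encode (k, enc z))] y \<longleftrightarrow> y = enc (g x k z)"
    "\<And>x y. rec_eval ea [enc x] y \<longleftrightarrow> y = a x"
    using assms unfolding computable_iff by (auto simp: enc_prod_def enc_nat_def)
  obtain t where t: "computes 3 t (\<lambda>xs. prod_encode (xs ! 2, prod_encode (xs ! 0, xs ! 1)))"
    using recursive_prod_encode[of 3 "\<lambda>xs. xs ! 2" "\<lambda>xs. prod_encode (xs ! 0, xs ! 1)"]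
      recursive_prod_encode[of 3 "\<lambda>xs. xs ! 0" "\<lambda>xs. xs ! 1"] recursive_proj
    by (auto simp: recursive_def)
  have "rec_eval (PrimRec eb (Comp eg [t])) [m, enc x] y \<longleftrightarrow> y = enc (rec_nat (b x) (g x) m)"
    for m x y
  proof (induction m arbitrary: y)
    case 0 then show ?case by (simp add: rec_eval_PrimRec_0_iff e)
  next
    case (Suc m)
    then show ?case using t
      by (simp add: rec_eval_PrimRec_Suc_iff rec_eval_Comp_iff list_all2_Cons1 e computes_def)
  qed
  then have "rec_eval (Comp (PrimRec eb (Comp eg [t])) [ea, Proj 0]) [enc x] y \<longleftrightarrow>
      y = enc (rec_nat (b x) (g x) (a x))" for x y
    by (simp add: rec_eval_Comp_iff list_all2_Cons1 e rec_eval_Proj_iff)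
  then show ?thesis unfolding computable_iff by blast
qed

section \<open>Arithmetic, truth values and comparisons\<close>

lemma computable_add: "computable a \<Longrightarrow> computable b \<Longrightarrow> computable (\<lambda>x. a x + b x :: nat)"
  by (rule recursive_computable2[of "(+)"]) (auto intro!: recursive_add recursive_proj)

lemma computable_diff: "computable a \<Longrightarrow> computable b \<Longrightarrow> computable (\<lambda>x. a x - b x :: nat)"
  by (rule recursive_computable2[of "(-)"]) (auto intro!: recursive_diff recursive_proj)

lemma computable_Suc: "computable a \<Longrightarrow> computable (\<lambda>x. Suc (a x))"
  by (rule recursive_computable1[of Suc]) (auto intro!: recursive_Suc recursive_proj)

lemma computable_mult:
  assumes "computable a" "computable b" shows "computable (\<lambda>x. a x * b x :: nat)"
proof -
  have "rec_nat 0 (\<lambda>k y. c + y) m = m * c" for m c :: nat by (induction m) auto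
  moreover have "computable (\<lambda>x. rec_nat 0 (\<lambda>k y. b x + y) (a x))"
    by (intro computable_rec_nat computable_const computable_add assms computable_snd computable_id
        computable_compose[OF assms(2)] computable_fst)
  ultimately show ?thesis by simp
qed

lemma computable_power:
  assumes "computable a" "computable b" shows "computable (\<lambda>x. a x ^ b x :: nat)"
proof -
  have "rec_nat 1 (\<lambda>k y. c * y) m = c ^ m" for m c :: nat by (induction m) auto
  moreover have "computable (\<lambda>x. rec_nat 1 (\<lambda>k y. a x * y) (b x))"
    by (intro computable_rec_nat computable_const computable_mult assms computable_snd computable_id
        computable_compose[OF assms(1)] computable_fst)
  ultimately show ?thesis by simp
qed

lemma computable_If:
  assumes "computable P" "computable a" "computable b"
  shows "computable (\<lambda>x. if P x then a x else b x)"
proof -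
  \<comment> \<open>The code of the condition is the number of iterations: none leaves the
    else-branch in place, one replaces it by the then-branch.\<close>
  have "computable (\<lambda>x. rec_nat (b x) (\<lambda>_ _. a x) (enc (P x)))"
    using assms(1)
    by (intro computable_rec_nat assms computable_compose[OF assms(2)] computable_fst computable_id)
       (simp add: computable_enc_iff)
  moreover have "rec_nat (b x) (\<lambda>_ _. a x) (enc (P x)) = (if P x then a x else b x)" for x
    by (simp add: enc_bool_def)
  ultimately show ?thesis by simp
qed

lemma computable_not: "computable P \<Longrightarrow> computable (\<lambda>x. \<not> P x)"
  using computable_If[of P "\<lambda>_. False" "\<lambda>_. True"] by (simp add: computable_const if_bool_eq_conj cong: if_cong)

lemma computable_conj: "computable P \<Longrightarrow> computable Q \<Longrightarrow> computable (\<lambda>x. P x \<and> Q x)"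
proof -
  assume "computable P" "computable Q"
  then have "computable (\<lambda>x. if P x then Q x else False)" by (intro computable_If computable_const)
  moreover have "(if P x then Q x else False) = (P x \<and> Q x)" for x by simp
  ultimately show ?thesis by simp
qed

lemma computable_disj: "computable P \<Longrightarrow> computable Q \<Longrightarrow> computable (\<lambda>x. P x \<or> Q x)"
  using computable_not[OF computable_conj[OF computable_not computable_not]] by simp

lemma computable_le:
  assumes "computable a" "computable b" shows "computable (\<lambda>x. a x \<le> (b x :: nat))"
proof -
  \<comment> \<open>With truncated subtraction, this number is the code of the truth value.\<close>
  have "computable (\<lambda>x. 1 - (a x - b x))" by (intro computable_diff computable_const assms)
  then show ?thesis by (rule computable_same_code) (auto simp: enc_nat_def enc_bool_def)
qed

lemma computable_less:
  assumes "computable a" "computable b" shows "computable (\<lambda>x. a x < (b x :: nat))"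
  using computable_le[OF computable_Suc[OF assms(1)] assms(2)] by (simp add: Suc_le_eq)

lemma computable_eq:
  assumes "computable a" "computable b" shows "computable (\<lambda>x. a x = b x)"
proof -
  have "computable (\<lambda>x. enc (a x) \<le> enc (b x) \<and> enc (b x) \<le> enc (a x))"
    using assms by (intro computable_conj computable_le) (simp_all add: computable_enc_iff)
  moreover have "enc (a x) \<le> enc (b x) \<and> enc (b x) \<le> enc (a x) \<longleftrightarrow> a x = b x" for x
    using inj_enc by (auto dest: injD intro: antisym)
  ultimately show ?thesis by simp
qed

section \<open>Bounded quantifiers, counting and unbounded search\<close>

lemma computable_ball_less:
  fixes P :: "_ \<Rightarrow> nat \<Rightarrow> bool"
  assumes "computable (\<lambda>p. P (fst p) (snd p))" "computable a"
  shows "computable (\<lambda>x. \<forall>i<a x. P x i)"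
proof -
  have "computable (\<lambda>x. rec_nat True (\<lambda>k y. y \<and> P x k) (a x))"
    by (intro computable_rec_nat assms computable_const computable_conj computable_snd computable_id
        computable_compose[OF assms(1), of "\<lambda>p. (fst p, fst (snd p))", simplified]
        computable_Pair computable_fst)
  moreover have "rec_nat True (\<lambda>k y. y \<and> P x k) m \<longleftrightarrow> (\<forall>i<m. P x i)" for x m
    by (induction m) (auto simp: less_Suc_eq)
  ultimately show ?thesis by simp
qed

lemma computable_card_less:
  fixes P :: "_ \<Rightarrow> nat \<Rightarrow> bool"
  assumes "computable (\<lambda>p. P (fst p) (snd p))" "computable a"
  shows "computable (\<lambda>x. card {i. i < a x \<and> P x i})"
proof -
  have "computable (\<lambda>x. rec_nat 0 (\<lambda>k y. if P x k then Suc y else y) (a x))"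
    by (intro computable_rec_nat assms computable_const computable_If computable_snd computable_id
        computable_compose[OF assms(1), of "\<lambda>p. (fst p, fst (snd p))", simplified]
        computable_Pair computable_fst computable_Suc)
  moreover have "rec_nat 0 (\<lambda>k y. if P x k then Suc y else y) m = card {i. i < m \<and> P x i}" for x m
  proof (induction m)
    case (Suc m)
    have "{i. i < Suc m \<and> P x i} = (if P x m then insert m {i. i < m \<and> P x i} else {i. i < m \<and> P x i})"
      by (auto simp: less_Suc_eq)
    with Suc show ?case by simp
  qed simp
  ultimately show ?thesis by simp
qed

text \<open>A \<open>\<mu>\<close>-program for the search is obtained from a program for the negated test,
  as \<^const>\<open>Mu\<close> looks for the value \<open>0\<close> and booleans are coded by \<open>0\<close> and \<open>1\<close>.\<close>

lemma partial_computable_Least: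
  assumes "computable (\<lambda>p. P (fst p) (snd p))"
  shows "partial_computable (\<lambda>x. if \<exists>k::nat. P x k then Some (LEAST k. P x k) else None)"
proof -
  obtain e where e: "\<And>x k y. rec_eval e [prod_encode (enc x, k)] y \<longleftrightarrow> y = enc (\<not> P x k)"
    using computable_not[OF assms] unfolding computable_iff by (auto simp: enc_prod_def enc_nat_def)
  obtain t where t: "computes 2 t (\<lambda>xs. prod_encode (xs ! 1, xs ! 0))"
    using recursive_prod_encode[of 2 "\<lambda>xs. xs ! 1" "\<lambda>xs. xs ! 0"] recursive_proj
    by (auto simp: recursive_def)
  have et: "rec_eval (Comp e [t]) [k, enc x] y \<longleftrightarrow> y = enc (\<not> P x k)" for x k y
    using t by (auto simp: rec_eval_Comp_iff list_all2_Cons1 e computes_def)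
  have "rec_eval (Mu (Comp e [t])) [enc x] y \<longleftrightarrow>
      (\<exists>b. (if \<exists>k. P x k then Some (LEAST k. P x k) else None) = Some b \<and> y = enc b)" for x y
  proof -
    have "rec_eval (Mu (Comp e [t])) [enc x] y \<longleftrightarrow> P x y \<and> (\<forall>i<y. \<not> P x i)"
      unfolding rec_eval_Mu_iff et by (auto simp: enc_bool_def)
    also have "\<dots> \<longleftrightarrow> (\<exists>k. P x k) \<and> y = (LEAST k. P x k)"
      by (metis LeastI Least_equality not_less not_less_Least)
    finally show ?thesis by (auto simp: enc_nat_def)
  qed
  then show ?thesis unfolding partial_computable_def by blast
qed

lemma computable_Least:
  assumes "computable (\<lambda>p. P (fst p) (snd p))" "\<And>x. \<exists>k::nat. P x k"
  shows "computable (\<lambda>x. LEAST k. P x k)"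
  using partial_computable_Least[OF assms(1)] assms(2) unfolding computable_def by simp

text \<open>The search for a least witness halts exactly where a witness exists.\<close>

lemma ce_set_Ex:
  assumes "computable (\<lambda>p. P (fst p) (snd p))"
  shows "ce_set {x. \<exists>k::nat. P x k}"
  unfolding ce_set_def
  by (rule exI, rule conjI[OF partial_computable_Least[OF assms]]) (auto split: if_splits)

text \<open>A number and the pair that it decodes to have the same code, so one program serves for
  both.\<close>

lemma computable_prod_decode: "computable a \<Longrightarrow> computable (\<lambda>x. prod_decode (a x))"
  by (erule computable_same_code) (simp add: enc_prod_def enc_nat_def)


subsection \<open>Lists\<close>

lemma enc_Nil [simp]: "enc [] = 0"
  by (simp add: enc_list_def)

lemma enc_Cons: "enc (x # xs) = Suc (prod_encode (enc x, enc xs))"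
  by (simp add: enc_list_def)

lemma computable_Cons:
  assumes "computable a" "computable b" shows "computable (\<lambda>x. a x # b x)"
proof -
  have "computable (\<lambda>x. Suc (enc (a x, b x)))"
    by (intro computable_Suc) (simp add: computable_enc_iff computable_Pair assms)
  then show ?thesis by (rule computable_same_code) (simp add: enc_Cons enc_prod_def enc_nat_def)
qed

lemma prod_decode_0: "prod_decode 0 = (0, 0)"
  using prod_encode_inverse[of "(0, 0)"] by (simp add: prod_encode_def)

lemma computable_tl:
  assumes "computable a" shows "computable (\<lambda>x. tl (a x))"
proof -
  have "computable (\<lambda>x. enc (a x))" using assms by (simp add: computable_enc_iff)
  then have "computable (\<lambda>x. snd (prod_decode (enc (a x) - 1)))"
    by (intro computable_snd computable_prod_decode computable_diff computable_const)
  moreover have "snd (prod_decode (enc xs - 1)) = enc (tl xs)" for xs :: "'b list"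
    by (cases xs) (auto simp: enc_Cons prod_decode_0)
  ultimately show ?thesis by (simp add: computable_enc_iff)
qed

lemma computable_drop:
  assumes "computable a" "computable b" shows "computable (\<lambda>x. drop (a x) (b x))"
proof -
  have "computable (\<lambda>x. rec_nat (b x) (\<lambda>_ y. tl y) (a x))"
    by (intro computable_rec_nat assms computable_tl computable_snd computable_id)
  moreover have "rec_nat xs (\<lambda>_ y. tl y) m = drop m xs" for xs :: "'b list" and m
    by (induction m) (auto simp: drop_Suc drop_tl)
  ultimately show ?thesis by simp
qed

text \<open>The length is found by search, as the least number of deletions that empties the
  list.\<close>

lemma computable_length:
  assumes "computable a" shows "computable (\<lambda>x. length (a x))"
proof -
  have "computable (\<lambda>x. LEAST k. drop k (a x) = [])"
  proof (rule computable_Least)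
    show "computable (\<lambda>p. drop (snd p) (a (fst p)) = [])"
      by (intro computable_eq computable_drop computable_snd computable_id computable_const
         computable_fst computable_compose[OF assms])
    show "\<exists>k. drop k (a x) = []" for x by (intro exI[of _ "length (a x)"]) simp
  qed
  moreover have "(LEAST k. drop k (a x) = []) = length (a x)" for x
    by (rule Least_equality) auto
  ultimately show ?thesis by simp
qed

text \<open>The default 0 makes list access total and computable, since \<open>xs ! i\<close> is
  unspecified beyond the end.\<close>

definition nth0 :: "nat list \<Rightarrow> nat \<Rightarrow> nat" where
  "nth0 xs i = (if i < length xs then xs ! i else 0)"

lemma computable_nth0:
  assumes "computable a" "computable b" shows "computable (\<lambda>x. nth0 (a x) (b x))"
proof -
  have "computable (\<lambda>x. enc (drop (b x) (a x)))"
    using assms by (simp add: computable_enc_iff computable_drop)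
  then have "computable (\<lambda>x. fst (prod_decode (enc (drop (b x) (a x)) - 1)))"
    by (intro computable_fst computable_prod_decode computable_diff computable_const)
  moreover have "fst (prod_decode (enc (drop i xs) - 1)) = nth0 xs i" for xs i
    by (cases "i < length xs")
       (auto simp: nth0_def enc_Cons enc_nat_def Cons_nth_drop_Suc[symmetric] prod_decode_0)
  ultimately show ?thesis by simp
qed

lemma enc_map_enc: "enc (map enc xs) = enc xs"
  by (simp add: enc_list_def enc_nat_def comp_def)

lemma computable_map_enc: "computable a \<Longrightarrow> computable (\<lambda>x. map enc (a x))"
  by (erule computable_same_code) (simp add: enc_map_enc)

lemma computable_list_decode: "computable a \<Longrightarrow> computable (\<lambda>x. list_decode (a x))"
  by (erule computable_same_code) (simp add: enc_list_def enc_nat_def[abs_def])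


lemmas computable_intros =
  computable_id computable_const computable_fst computable_snd computable_Pair computable_add
  computable_diff computable_Suc computable_mult computable_power computable_If computable_not
  computable_conj computable_disj computable_le computable_less computable_eq computable_prod_decode
  computable_Cons computable_tl computable_length computable_nth0 computable_map_enc

section \<open>Step-bounded evaluation\<close>

text \<open>The value \<open>0\<close> means that the fuel \<open>t\<close> does not suffice, and \<open>Suc y\<close> stands for the result \<open>y\<close>.
  Fuel only bounds the searches of \<^const>\<open>Mu\<close>.\<close>

fun fuel_eval :: "recf \<Rightarrow> nat \<Rightarrow> nat list \<Rightarrow> nat" where
  "fuel_eval Zero t xs = 1"
| "fuel_eval Succ t xs = (if length xs = 1 then Suc (Suc (nth0 xs 0)) else 0)"
| "fuel_eval (Proj i) t xs = (if i < length xs then Suc (nth0 xs i) else 0)"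
| "fuel_eval (Comp f gs) t xs =
     (if \<exists>g\<in>set gs. fuel_eval g t xs = 0 then 0
      else fuel_eval f t (map (\<lambda>g. fuel_eval g t xs - 1) gs))"
| "fuel_eval (PrimRec f g) t xs =
     (if xs = [] then 0
      else rec_nat (fuel_eval f t (tl xs))
        (\<lambda>k y. if y = 0 then 0 else fuel_eval g t (k # (y - 1) # tl xs)) (nth0 xs 0))"
| "fuel_eval (Mu f) t xs =
     (if (LEAST n. t \<le> n \<or> fuel_eval f t (n # xs) < 2) < t \<and>
         fuel_eval f t ((LEAST n. t \<le> n \<or> fuel_eval f t (n # xs) < 2) # xs) = 1
      then Suc (LEAST n. t \<le> n \<or> fuel_eval f t (n # xs) < 2) else 0)"

declare fuel_eval.simps(4-6) [simp del]

text \<open>Successful runs obey the same clauses as \<open>rec_eval\<close>; soundness and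
  completeness use this form in place of the defining equation.\<close>

lemma fuel_eval_Comp_eq_Suc:
  "fuel_eval (Comp f gs) t xs = Suc z \<longleftrightarrow>
     (\<exists>ys. list_all2 (\<lambda>g y. fuel_eval g t xs = Suc y) gs ys \<and> fuel_eval f t ys = Suc z)"
proof -
  have "list_all2 (\<lambda>g y. fuel_eval g t xs = Suc y) gs ys \<longleftrightarrow>
      (\<forall>g\<in>set gs. fuel_eval g t xs \<noteq> 0) \<and> ys = map (\<lambda>g. fuel_eval g t xs - 1) gs" for ys
    by (induction gs arbitrary: ys) (auto simp: list_all2_Cons1)
  then show ?thesis by (auto simp: fuel_eval.simps(4))
qed

lemma fuel_eval_PrimRec_Nil: "fuel_eval (PrimRec f g) t [] = 0"
  by (simp add: fuel_eval.simps)

lemma fuel_eval_PrimRec_Cons: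
  "fuel_eval (PrimRec f g) t (n # xs) =
     rec_nat (fuel_eval f t xs) (\<lambda>k y. if y = 0 then 0 else fuel_eval g t (k # (y - 1) # xs)) n"
  unfolding fuel_eval.simps list.sel by (simp add: nth0_def)

lemma fuel_eval_PrimRec_0: "fuel_eval (PrimRec f g) t (0 # xs) = fuel_eval f t xs"
  by (simp add: fuel_eval_PrimRec_Cons)

lemma fuel_eval_PrimRec_Suc_eq_Suc:
  "fuel_eval (PrimRec f g) t (Suc n # xs) = Suc z \<longleftrightarrow>
     (\<exists>y. fuel_eval (PrimRec f g) t (n # xs) = Suc y \<and> fuel_eval g t (n # y # xs) = Suc z)"
  by (auto simp: fuel_eval_PrimRec_Cons gr0_conv_Suc)

text \<open>The search stops at the bound \<open>t\<close> or at the first test value below 2. There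
  1 stands for the result 0, and 0 for a test that is undecided with this fuel; only the former is a
  success.\<close>

lemma fuel_eval_Mu_eq_Suc:
  "fuel_eval (Mu f) t xs = Suc m \<longleftrightarrow>
     m < t \<and> fuel_eval f t (m # xs) = 1 \<and> (\<forall>i<m. 2 \<le> fuel_eval f t (i # xs))"
proof -
  define l where "l = (LEAST n. t \<le> n \<or> fuel_eval f t (n # xs) < 2)"
  have "m < t \<and> fuel_eval f t (m # xs) = 1 \<and> (\<forall>i<m. 2 \<le> fuel_eval f t (i # xs)) \<Longrightarrow> l = m"
    unfolding l_def by (rule Least_equality) (auto simp: not_less[symmetric])
  moreover have "i < l \<Longrightarrow> 2 \<le> fuel_eval f t (i # xs)" for i
    unfolding l_def by (drule not_less_Least) auto
  ultimately show ?thesis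
    by (auto simp: fuel_eval.simps(6) l_def[symmetric] split: if_splits)
qed

text \<open>A result, once reached, is stable under more fuel. This is what allows the fuels of
  several subcomputations to be merged.\<close>

lemma fuel_eval_mono:
  "fuel_eval e t xs = Suc y \<Longrightarrow> t \<le> t' \<Longrightarrow> fuel_eval e t' xs = Suc y"
proof (induction e arbitrary: xs y)
  case (Comp f gs)
  then obtain ys where "list_all2 (\<lambda>g y. fuel_eval g t xs = Suc y) gs ys" "fuel_eval f t ys = Suc y"
    unfolding fuel_eval_Comp_eq_Suc by blast
  with Comp show ?case
    unfolding fuel_eval_Comp_eq_Suc by (intro exI[of _ ys]) (auto elim!: list.rel_mono_strong)
next
  case (PrimRec f g)
  show ?case
  proof (cases xs)
    case Nil
    with PrimRec show ?thesis by (simp add: fuel_eval_PrimRec_Nil)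
  next
    case (Cons n zs)
    have "fuel_eval (PrimRec f g) t (n # zs) = Suc y \<Longrightarrow> fuel_eval (PrimRec f g) t' (n # zs) = Suc y"
      using PrimRec.IH PrimRec.prems(2) by (induction n arbitrary: y)
        (auto simp: fuel_eval_PrimRec_0 fuel_eval_PrimRec_Suc_eq_Suc)
    with Cons PrimRec.prems show ?thesis by simp
  qed
next
  case (Mu f)
  have "2 \<le> fuel_eval f t' (i # xs)" if "2 \<le> fuel_eval f t (i # xs)" for i
    using that Mu.IH[of "i # xs" "fuel_eval f t (i # xs) - 1"] Mu.prems(2) by simp
  with Mu show ?case unfolding fuel_eval_Mu_eq_Suc by auto
qed (auto split: if_splits)

lemma fuel_eval_sound: "fuel_eval e t xs = Suc y \<Longrightarrow> rec_eval e xs y"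
proof (induction e arbitrary: xs y)
  case (Comp f gs)
  then obtain ys where "list_all2 (\<lambda>g y. fuel_eval g t xs = Suc y) gs ys" "fuel_eval f t ys = Suc y"
    unfolding fuel_eval_Comp_eq_Suc by blast
  with Comp show ?case
    unfolding rec_eval_Comp_iff by (intro exI[of _ ys]) (auto elim!: list.rel_mono_strong)
next
  case (PrimRec f g)
  show ?case
  proof (cases xs)
    case Nil
    with PrimRec show ?thesis by (simp add: fuel_eval_PrimRec_Nil)
  next
    case (Cons n zs)
    have "fuel_eval (PrimRec f g) t (n # zs) = Suc y \<Longrightarrow> rec_eval (PrimRec f g) (n # zs) y"
    proof (induction n arbitrary: y)
      case 0
      then show ?case using PrimRec.IH(1) by (simp add: rec_eval_PrimRec_0_iff fuel_eval_PrimRec_0)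
    next
      case (Suc n)
      then show ?case using PrimRec.IH(2)
        by (auto simp: rec_eval_PrimRec_Suc_iff fuel_eval_PrimRec_Suc_eq_Suc)
    qed
    with Cons PrimRec.prems show ?thesis by simp
  qed
next
  case (Mu f)
  have "\<exists>z. rec_eval f (i # xs) (Suc z)" if "2 \<le> fuel_eval f t (i # xs)" for i
  proof -
    have "fuel_eval f t (i # xs) = Suc (Suc (fuel_eval f t (i # xs) - 2))" using that by simp
    then show ?thesis using Mu.IH by blast
  qed
  moreover have "fuel_eval f t (y # xs) = Suc 0" "\<forall>i<y. 2 \<le> fuel_eval f t (i # xs)"
    using Mu.prems unfolding fuel_eval_Mu_eq_Suc by auto
  ultimately show ?case using Mu.IH[of "y # xs" 0] unfolding rec_eval_Mu_iff by blast
qed (auto split: if_splits simp: rec_eval_Zero_iff rec_eval_Succ_iff rec_eval_Proj_iff nth0_def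
      length_Suc_conv)

text \<open>For properties that are upward closed in \<open>t\<close>, the sum of finitely many
  witnesses is a witness for all of them.\<close>

lemma common_bound_less:
  fixes P :: "nat \<Rightarrow> nat \<Rightarrow> bool"
  assumes "\<forall>i<n. \<exists>t. P i t" and mono: "\<And>i t t'. P i t \<Longrightarrow> t \<le> t' \<Longrightarrow> P i t'"
  shows "\<exists>t. \<forall>i<n. P i t"
proof -
  obtain t where t: "\<forall>i<n. P i (t i)" using assms(1) by metis
  have "P i (\<Sum>i<n. t i)" if "i < n" for i
  proof (rule mono)
    show "P i (t i)" using t that by blast
    show "t i \<le> (\<Sum>i<n. t i)" using that by (intro member_le_sum) auto
  qed
  then show ?thesis by blast
qed

lemma fuel_eval_complete: "rec_eval e xs y \<Longrightarrow> \<exists>t. fuel_eval e t xs = Suc y"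
proof (induction rule: rec_eval.induct)
  case (4 xs gs ys f z)
  have all: "\<forall>i<length gs. \<exists>t. fuel_eval (gs ! i) t xs = Suc (ys ! i)" and len: "length gs = length ys"
    using 4(1) by (auto simp: list_all2_conv_all_nth)
  obtain t where t: "\<forall>i<length gs. fuel_eval (gs ! i) t xs = Suc (ys ! i)"
    using common_bound_less[OF all] fuel_eval_mono by blast
  obtain s where s: "fuel_eval f s ys = Suc z" using 4(2) by blast
  have "fuel_eval (gs ! i) (max s t) xs = Suc (ys ! i)" if "i < length gs" for i
    using t that by (intro fuel_eval_mono[OF _ max.cobounded2]) blast
  moreover have "fuel_eval f (max s t) ys = Suc z" by (rule fuel_eval_mono[OF s max.cobounded1])
  ultimately show ?case using len
    by (intro exI[of _ "max s t"])
       (auto simp: fuel_eval_Comp_eq_Suc list_all2_conv_all_nth)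
next
  case (5 f xs y g)
  then show ?case by (simp add: fuel_eval_PrimRec_0)
next
  case (6 f g n xs y z)
  then obtain s t where "fuel_eval (PrimRec f g) s (n # xs) = Suc y" "fuel_eval g t (n # y # xs) = Suc z"
    by blast
  then have "fuel_eval (PrimRec f g) (max s t) (n # xs) = Suc y"
    "fuel_eval g (max s t) (n # y # xs) = Suc z"
    by (auto intro: fuel_eval_mono)
  then show ?case by (auto simp: fuel_eval_PrimRec_Suc_eq_Suc)
next
  case (7 f n xs)
  then have "\<forall>i<n. \<exists>t. 2 \<le> fuel_eval f t (i # xs)"
    by (metis Suc_1 Suc_le_mono le0 One_nat_def)
  moreover have "2 \<le> fuel_eval f t (i # xs) \<Longrightarrow> t \<le> t' \<Longrightarrow> 2 \<le> fuel_eval f t' (i # xs)" for i t t'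
    using fuel_eval_mono[of f t "i # xs" "fuel_eval f t (i # xs) - 1" t'] by simp
  ultimately obtain t where t: "\<forall>i<n. 2 \<le> fuel_eval f t (i # xs)"
    and mono: "\<And>i t t'. 2 \<le> fuel_eval f t (i # xs) \<Longrightarrow> t \<le> t' \<Longrightarrow> 2 \<le> fuel_eval f t' (i # xs)"
    using common_bound_less[of n "\<lambda>i t. 2 \<le> fuel_eval f t (i # xs)"] by blast
  obtain s where s: "fuel_eval f s (n # xs) = 1" using 7 by auto
  show ?case
    unfolding fuel_eval_Mu_eq_Suc
  \<comment> \<open>The fuel has to exceed the result \<open>n\<close>, as it also bounds the
    search, and to dominate \<open>s\<close> and \<open>t\<close>.\<close>
  proof (intro exI[of _ "Suc (n + s + t)"] conjI allI impI)
    show "fuel_eval f (Suc (n + s + t)) (n # xs) = 1"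
      using fuel_eval_mono[of f s "n # xs" 0 "Suc (n + s + t)"] s by simp
    show "2 \<le> fuel_eval f (Suc (n + s + t)) (i # xs)" if "i < n" for i
      using t that by (intro mono[OF _ le_SucI[OF le_add2]]) blast
  qed simp
qed (auto simp: nth0_def)

lemma rec_eval_iff_fuel_eval: "rec_eval e xs y \<longleftrightarrow> (\<exists>t. fuel_eval e t xs = Suc y)"
  using fuel_eval_sound fuel_eval_complete by blast

text \<open>The program \<open>e\<close> is fixed, so induction on it builds an evaluator for each
  program separately; programs need not be coded by numbers.\<close>

lemma computable_fuel_eval_pair: "computable (\<lambda>p. fuel_eval e (fst p) (snd p))"
proof (induction e)
  case (Comp f gs)
  \<comment> \<open>The list of subprograms is fixed too, so the test over it and the list of values
    unfold into finitely many computable expressions.\<close>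
  have "(\<forall>g\<in>set hs. computable (\<lambda>p. fuel_eval g (fst p) (snd p))) \<Longrightarrow>
      computable (\<lambda>p. \<exists>g\<in>set hs. fuel_eval g (fst p) (snd p) = 0) \<and>
      computable (\<lambda>p. map (\<lambda>g. fuel_eval g (fst p) (snd p) - 1) hs)" for hs
    by (induction hs) (auto intro!: computable_intros)
  from this[of gs] Comp show ?case
    unfolding fuel_eval.simps
    by (intro computable_If computable_const computable_compose[OF Comp(1), of
          "\<lambda>p. (fst p, map (\<lambda>g. fuel_eval g (fst p) (snd p) - 1) gs)", unfolded fst_conv snd_conv])
       (auto intro!: computable_Pair computable_intros(1,3))
next
  case (PrimRec f g)
  show ?case
    unfolding fuel_eval.simps
    by (intro computable_intros computable_rec_nat
        computable_compose[OF PrimRec(1), of "\<lambda>p. (fst p, tl (snd p))", unfolded fst_conv snd_conv]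
        computable_compose[OF PrimRec(2), of "\<lambda>q. (fst (fst q), fst (snd q) # (snd (snd q) - 1) # tl (snd (fst q)))", unfolded fst_conv snd_conv])
next
  case (Mu f)
  \<comment> \<open>The alternative \<open>fst p \<le> n\<close> makes this search total.\<close>
  have least: "computable (\<lambda>p. LEAST n. fst p \<le> n \<or> fuel_eval f (fst p) (n # snd p) < 2)"
    by (intro computable_Least computable_intros
        computable_compose[OF Mu, of "\<lambda>q. (fst (fst q), snd q # snd (fst q))", unfolded fst_conv snd_conv]) auto
  show ?case
    unfolding fuel_eval.simps
    by (intro computable_intros least computable_compose[OF Mu, of
        "\<lambda>p. (fst p, (LEAST n. fst p \<le> n \<or> fuel_eval f (fst p) (n # snd p) < 2) # snd p)", unfolded fst_conv snd_conv])
qed (auto intro!: computable_intros)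

lemma computable_fuel_eval:
  assumes "computable a" "computable b" shows "computable (\<lambda>x. fuel_eval e (a x) (b x))"
  using computable_compose[OF computable_fuel_eval_pair computable_Pair[OF assms]] by simp

text \<open>A partial function is traded for a total one with a stage argument: statements about its
  values become existential over a decidable condition, the form that \<open>ce_set_Ex\<close>
  requires.\<close>

lemma partial_computable_stages:
  fixes F :: "'a::encodable \<rightharpoonup> 'b::encodable"
  assumes "partial_computable F"
  shows "\<exists>G :: 'a \<Rightarrow> nat \<Rightarrow> nat. computable (\<lambda>p. G (fst p) (snd p)) \<and>
    (\<forall>a b. F a = Some b \<longleftrightarrow> (\<exists>t. G a t = Suc (enc b)))"
proof -
  obtain e where e: "\<And>a y. rec_eval e [enc a] y \<longleftrightarrow> (\<exists>b. F a = Some b \<and> y = enc b)"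
    using assms unfolding partial_computable_def by blast
  show ?thesis
  proof (intro exI[of _ "\<lambda>a t. fuel_eval e t [enc a]"] conjI allI)
    show "computable (\<lambda>p. fuel_eval e (snd p) [enc (fst p)])"
      by (intro computable_fuel_eval computable_intros) (simp add: computable_enc_iff computable_intros)
    show "F a = Some b \<longleftrightarrow> (\<exists>t. fuel_eval e t [enc a] = Suc (enc b))" for a b
      using e[of a "enc b"] inj_enc unfolding rec_eval_iff_fuel_eval by (auto dest: injD)
  qed
qed


section \<open>Binary strings in length-lexicographical order\<close>

text \<open>The bits of \<open>string_index u + 1\<close> are those of \<open>u\<close> with a leading \<open>1\<close>.\<close>

definition string_index :: "bool list \<Rightarrow> nat" where
  "string_index u = foldl (\<lambda>n x. 2 * n + 1 + (if x then 1 else 0)) 0 u"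

definition nth_string :: "nat \<Rightarrow> bool list" where
  "nth_string = inv string_index"

lemma string_index_Nil [simp]: "string_index [] = 0"
  by (simp add: string_index_def)

lemma string_index_snoc [simp]:
  "string_index (u @ [x]) = 2 * string_index u + 1 + (if x then 1 else 0)"
  by (simp add: string_index_def)

text \<open>The first bound turns a small index into a short program, the second limits the index of
  a program of given length.\<close>

lemma string_index_bounds:
  "2 ^ length u \<le> Suc (string_index u)" "Suc (string_index u) < 2 * 2 ^ length u"
  by (induction u rule: rev_induct) auto

lemma string_index_surj: "\<exists>u. string_index u = n"
proof (induction n rule: less_induct)
  case (less n)
  show ?case
  proof (cases n)
    case 0 then show ?thesis by (intro exI[of _ "[]"]) simp
  next
    case (Suc m)
    then have "m div 2 < n" by simp
    with less obtain u where u: "string_index u = m div 2" by blast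
    \<comment> \<open>The parity of \<open>m = n - 1\<close> is the last bit, and
      \<open>m div 2\<close> is the index of the rest.\<close>
    have "string_index (u @ [odd m]) = n" using u Suc by (auto elim: evenE oddE)
    then show ?thesis ..
  qed
qed

lemma string_index_Cons:
  "string_index (x # u) = string_index u + (if x then 2 else 1) * 2 ^ length u"
  by (induction u rule: rev_induct) (simp_all add: string_index_def)

text \<open>Strings of different lengths are separated by the bounds on the index. For equal
  lengths, the first difference contributes a power of two that the remaining bits cannot make up
  for.\<close>

lemma string_index_strict_mono:
  assumes "(u, v) \<in> lenlex {(x, y). x < y}" shows "string_index u < string_index v"
proof (cases "length u < length v")
  case True
  then have "(2::nat) * 2 ^ length u \<le> 2 ^ length v"
    by (metis Suc_leI power_Suc power_increasing one_le_numeral)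
  then show ?thesis using string_index_bounds[of u] string_index_bounds[of v] by linarith
next
  case False
  with assms have "(u, v) \<in> lex {(x, y). x < y}" "length u = length v"
    by (auto simp: lenlex_conv)
  then show ?thesis
  proof (induction u v rule: list_induct2')
    case (4 x u y v)
    then consider "x < y" | "x = y" "(u, v) \<in> lex {(x, y). x < y}" by auto
    then show ?case
    proof cases
      case 1
      then have "\<not> x" "y" by (auto simp: less_bool_def)
      then show ?thesis using string_index_bounds[of u] string_index_bounds[of v] 4(3) by (simp add: string_index_Cons)
    next
      case 2
      with 4 show ?thesis by (simp add: string_index_Cons)
    qed
  qed auto
qed

lemma string_index_inj: "inj string_index"
proof (rule injI, rule ccontr)
  fix u v assume eq: "string_index u = string_index v" and "u \<noteq> v"
  have "total (lenlex {(x, y). x < (y::bool)})"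
    by (rule total_lenlex) (auto simp: total_on_def)
  with \<open>u \<noteq> v\<close> have "(u, v) \<in> lenlex {(x, y). x < y} \<or> (v, u) \<in> lenlex {(x, y). x < y}"
    by (auto simp: total_on_def)
  with eq string_index_strict_mono[of u v] string_index_strict_mono[of v u] show False by auto
qed

lemma nth_string_index [simp]: "nth_string (string_index u) = u"
  unfolding nth_string_def using string_index_inj by simp

lemma string_index_nth [simp]: "string_index (nth_string n) = n"
  unfolding nth_string_def using string_index_surj by (metis surjI surj_f_inv_f)

lemma string_index_rec_nat:
  "string_index u = rec_nat 0 (\<lambda>i n. 2 * n + 1 + nth0 (map enc u) i) (length u)"
proof -
  have "rec_nat 0 (\<lambda>i n. 2 * n + 1 + nth0 (map enc u) i) m = string_index (take m u)"
    if "m \<le> length u" for m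
    using that by (induction m) (auto simp: take_Suc_conv_app_nth nth0_def enc_bool_def)
  then show ?thesis by simp
qed

lemma computable_string_index:
  assumes "computable a" shows "computable (\<lambda>x. string_index (a x))"
proof -
  have "computable (\<lambda>u. string_index u)"
    unfolding string_index_rec_nat by (intro computable_rec_nat computable_intros)
  from computable_compose[OF this assms] show ?thesis .
qed

text \<open>A code for a string is searched among all codes of lists of numbers.\<close>

lemma computable_nth_string:
  assumes "computable a" shows "computable (\<lambda>x. nth_string (a x))"
proof -
  define val where "val c = rec_nat 0 (\<lambda>i n. 2 * n + 1 + nth0 (list_decode c) i) (length (list_decode c))" for c
  define P where "P n c \<longleftrightarrow> (\<forall>i<length (list_decode c). nth0 (list_decode c) i \<le> 1) \<and> val c = n" for n c
  \<comment> \<open>Entries at most 1 are exactly codes of bits, and the index determines the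
    string, so the search has a unique solution.\<close>
  have P: "P n c \<longleftrightarrow> c = enc (nth_string n)" for n c
  proof
    assume "P n c"
    define u where "u = map (\<lambda>k. k = 1) (list_decode c)"
    have "map enc u = list_decode c"
      using \<open>P n c\<close> unfolding u_def P_def
      by (auto simp: list_eq_iff_nth_eq nth0_def enc_bool_def le_Suc_eq)
    then have "enc u = c" and "string_index u = val c"
      by (auto simp: enc_list_def val_def string_index_rec_nat)
        (metis length_map)
    moreover have "val c = n" using \<open>P n c\<close> by (simp add: P_def)
    ultimately show "c = enc (nth_string n)" by auto
  next
    assume c: "c = enc (nth_string n)"
    then have "list_decode c = map enc (nth_string n)" by (simp add: enc_list_def)
    then show "P n c"
      using string_index_rec_nat[of "nth_string n"] by (simp add: P_def val_def nth0_def enc_bool_def)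
  qed
  have "computable (\<lambda>n. LEAST c. P n c)"
  proof (rule computable_Least)
    show "computable (\<lambda>p. P (fst p) (snd p))"
      unfolding P_def val_def
      by (intro computable_intros computable_list_decode computable_ball_less computable_rec_nat)
    show "\<exists>c. P n c" for n unfolding P by blast
  qed
  then have "computable (\<lambda>n. enc (nth_string n))"
    unfolding P by (simp add: Least_equality)
  then have "computable nth_string" by (simp only: computable_enc_iff)
  from computable_compose[OF this assms] show ?thesis .
qed


section \<open>Trees, the metric and covering numbers\<close>

lemma length_restr [simp]: "length (restr f n) = n"
  by (simp add: restr_def)

lemma nth_restr [simp]: "i < n \<Longrightarrow> restr f n ! i = f i"
  by (simp add: restr_def)

lemma restr_eq_iff: "restr f n = restr g n \<longleftrightarrow> (\<forall>i<n. f i = g i)"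
  by (auto simp: list_eq_iff_nth_eq)

lemma restr_eq_conv: "restr f (length xs) = xs \<longleftrightarrow> (\<forall>i<length xs. f i = xs ! i)"
  by (auto simp: list_eq_iff_nth_eq)

lemma level_disjoint_successors:
  "\<sigma> \<noteq> \<tau> \<Longrightarrow> successors S \<sigma> \<inter> successors S \<tau> = {}"
  by (auto simp: successors_def)

lemma restr_in_level: "f \<in> paths S \<Longrightarrow> restr f n \<in> level S n"
  by (auto simp: paths_def level_def)

section \<open>Leafless finitely branching trees\<close>

locale leafless_tree =
  fixes S :: "nat list set"
  assumes tree: "is_tree S" and fin_branching: "finitely_branching S" and no_leaf: "\<not> (\<exists>\<sigma>. leaf S \<sigma>)"
begin

lemma prefix_closed: "\<tau> \<in> S \<Longrightarrow> prefix \<sigma> \<tau> \<Longrightarrow> \<sigma> \<in> S"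
  using tree unfolding is_tree_def by blast

lemma Nil_in_tree: "[] \<in> S"
  using tree prefix_closed unfolding is_tree_def by fastforce

lemma level_0: "level S 0 = {[]}"
  using Nil_in_tree by (auto simp: level_def)

lemma level_Suc: "level S (Suc n) = (\<Union>\<sigma>\<in>level S n. successors S \<sigma>)"
proof
  show "level S (Suc n) \<subseteq> (\<Union>\<sigma>\<in>level S n. successors S \<sigma>)"
  proof
    fix \<tau> assume \<tau>: "\<tau> \<in> level S (Suc n)"
    then have "\<tau> = butlast \<tau> @ [last \<tau>]" "\<tau> \<in> S"
      by (cases \<tau> rule: rev_cases; simp add: level_def)+
    moreover from this have "butlast \<tau> \<in> S" using prefix_closed by (metis prefixI)
    ultimately show "\<tau> \<in> (\<Union>\<sigma>\<in>level S n. successors S \<sigma>)"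
      using \<tau> by (auto simp: level_def successors_def intro!: bexI[of _ "butlast \<tau>"])
  qed
qed (auto simp: level_def successors_def)

lemma finite_successors: "\<sigma> \<in> level S n \<Longrightarrow> finite (successors S \<sigma>)"
  using fin_branching by (auto simp: finitely_branching_def level_def)

lemma finite_level: "finite (level S n)"
  by (induction n) (auto simp: level_0 level_Suc intro: finite_successors)

lemma card_level_Suc: "card (level S (Suc n)) = (\<Sum>\<sigma>\<in>level S n. card (successors S \<sigma>))"
  unfolding level_Suc
  using level_disjoint_successors by (intro card_UN_disjoint) (auto intro: finite_level finite_successors)

lemma card_successors_pos: "\<sigma> \<in> level S n \<Longrightarrow> 0 < card (successors S \<sigma>)"
  using finite_successors no_leaf by (auto simp: leaf_def card_gt_0_iff level_def)

lemma card_level_le_Suc: "card (level S n) \<le> card (level S (Suc n))"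
proof -
  have "card (level S n) = (\<Sum>\<sigma>\<in>level S n. 1)" by simp
  also have "\<dots> \<le> card (level S (Suc n))"
    unfolding card_level_Suc using card_successors_pos by (intro sum_mono) (auto simp: Suc_le_eq)
  finally show ?thesis .
qed

lemma card_level_mono: "m \<le> n \<Longrightarrow> card (level S m) \<le> card (level S n)"
  by (rule lift_Suc_mono_le[of "\<lambda>n. card (level S n)"]) (auto simp: card_level_le_Suc)

lemma card_level_pos: "0 < card (level S n)"
  using card_level_mono[of 0 n] by (simp add: level_0)

text \<open>Without leaves, a node can be extended one entry at a time; dependent choice gives a
  chain of nodes whose union is the path.\<close>

lemma path_through_node:
  assumes "\<sigma> \<in> S" obtains f where "f \<in> paths S" "restr f (length \<sigma>) = \<sigma>"
proof -
  have "\<exists>node. \<forall>k. (node k \<in> S \<and> length (node k) = length \<sigma> + k \<and> (k = 0 \<longrightarrow> node k = \<sigma>)) \<and>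
      (\<exists>j. node (Suc k) = node k @ [j])"
  proof (rule dependent_nat_choice)
    show "\<exists>\<tau>. \<tau> \<in> S \<and> length \<tau> = length \<sigma> + 0 \<and> (0 = 0 \<longrightarrow> \<tau> = \<sigma>)" using assms by auto
  next
    fix \<tau> and n :: nat assume "\<tau> \<in> S \<and> length \<tau> = length \<sigma> + n \<and> (n = 0 \<longrightarrow> \<tau> = \<sigma>)"
    then show "\<exists>\<rho>. (\<rho> \<in> S \<and> length \<rho> = length \<sigma> + Suc n \<and> (Suc n = 0 \<longrightarrow> \<rho> = \<sigma>)) \<and> (\<exists>j. \<rho> = \<tau> @ [j])"
      using no_leaf by (fastforce simp: leaf_def successors_def)
  qed
  then obtain node where node: "\<And>k. node k \<in> S" "\<And>k. length (node k) = length \<sigma> + k" "node 0 = \<sigma>"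
    "\<And>k. \<exists>j. node (Suc k) = node k @ [j]" by metis
  have nth_Suc: "i < length (node k) \<Longrightarrow> node (Suc k) ! i = node k ! i" for i k
    using node(4)[of k] by (auto simp: nth_append)
  have nth_eq: "i < length (node k) \<Longrightarrow> node (k + l) ! i = node k ! i" for i k l
    by (induction l) (use node(2) in \<open>auto simp: nth_Suc\<close>)
  \<comment> \<open>The node \<open>node (Suc i)\<close> has more than \<open>i\<close> entries, and
    by coherence every node in the chain of length greater than \<open>i\<close> has the same entry
    there.\<close>
  define f where "f i = node (Suc i) ! i" for i
  have f: "f i = node k ! i" if "i < length (node k)" for i k
  proof (cases "k \<le> Suc i")
    case True
    then show ?thesis using nth_eq[OF that, of "Suc i - k"] by (simp add: f_def)
  next
    case False
    then show ?thesis using nth_eq[of i "Suc i" "k - Suc i"] node(2)[of "Suc i"] by (simp add: f_def)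
  qed
  have "restr f n = take n (node n)" for n
    by (rule nth_equalityI) (simp_all add: node(2) f[of _ n])
  then have "restr f n \<in> S" for n using node(1) prefix_closed take_is_prefix by metis
  then have "f \<in> paths S" by (simp add: paths_def)
  moreover have "restr f (length \<sigma>) = \<sigma>" unfolding restr_eq_conv using f[of _ 0] node(3) by auto
  ultimately show thesis by (rule that)
qed

end

section \<open>Trees with at least two successors at each node: scales and covering numbers\<close>

locale doubling_tree =
  fixes T :: "nat list set"
  assumes tree: "is_tree T" and fin_branching: "finitely_branching T"
    and two_successors: "\<forall>\<sigma>\<in>T. 2 \<le> card (successors T \<sigma>)"

sublocale doubling_tree \<subseteq> leafless_tree T
proof
  show "\<not> (\<exists>\<sigma>. leaf T \<sigma>)" using two_successors by (fastforce simp: leaf_def)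
qed (fact tree fin_branching)+

context doubling_tree
begin

lemma card_level_ge_power2: "2 ^ n \<le> card (level T n)"
proof (induction n)
  case 0 then show ?case by (simp add: level_0)
next
  case (Suc n)
  have "card (level T n) * 2 = (\<Sum>\<sigma>\<in>level T n. 2)" by simp
  also have "\<dots> \<le> card (level T (Suc n))"
    unfolding card_level_Suc using two_successors by (intro sum_mono) (auto simp: level_def)
  finally show ?case using Suc by simp
qed

text \<open>Agreement up to \<open>n\<close> is downward closed in \<open>n\<close>, and a position
  where \<open>f\<close> and \<open>g\<close> differ bounds it, so the greatest such
  \<open>n\<close> exists.\<close>

lemma restr_eq_iff_le_Greatest:
  assumes "f \<noteq> g"
  shows "restr f n = restr g n \<longleftrightarrow> n \<le> (GREATEST n. restr f n = restr g n)"
proof -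
  obtain k where k: "f k \<noteq> g k" using assms by auto
  have bound: "n \<le> k" if "restr f n = restr g n" for n
    using that k unfolding restr_eq_iff by (meson not_less)
  have "restr f 0 = restr g 0" by (simp add: restr_def)
  then have "restr f (GREATEST n. restr f n = restr g n) = restr g (GREATEST n. restr f n = restr g n)"
    using bound by (rule GreatestI_nat)
  then have "n \<le> (GREATEST n. restr f n = restr g n) \<Longrightarrow> restr f n = restr g n"
    unfolding restr_eq_iff by simp
  moreover have "restr f n = restr g n \<Longrightarrow> n \<le> (GREATEST n. restr f n = restr g n)"
    by (rule Greatest_le_nat[where b = k]) (auto dest: bound)
  ultimately show ?thesis by blast
qed

text \<open>Closed balls of radius \<open>\<alpha>\<close> are the cylinders of the nodes of length \<open>scale \<alpha>\<close>.\<close>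

definition scale :: "real \<Rightarrow> nat" where
  "scale \<alpha> = (LEAST n. 1 / real (card (level T n)) \<le> \<alpha>)"

text \<open>The cardinalities of the levels are nondecreasing and, being at least
  \<open>2 ^ n\<close>, unbounded; hence the least \<open>n\<close> exists and all larger ones
  qualify.\<close>

lemma scale_le_iff:
  assumes "0 < \<alpha>" shows "scale \<alpha> \<le> n \<longleftrightarrow> 1 / real (card (level T n)) \<le> \<alpha>"
proof
  obtain m where m: "inverse \<alpha> < 2 ^ m" using real_arch_pow[of 2] by auto
  have "1 / real (card (level T m)) \<le> \<alpha>"
  proof -
    have "inverse \<alpha> \<le> real (card (level T m))"
      using m card_level_ge_power2[of m] by (metis le_less_trans less_le_not_le linorder_not_le
          of_nat_le_iff of_nat_numeral of_nat_power order_trans)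
    then show ?thesis using assms card_level_pos[of m] by (simp add: field_simps)
  qed
  then have *: "1 / real (card (level T (scale \<alpha>))) \<le> \<alpha>" unfolding scale_def by (rule LeastI)
  assume "scale \<alpha> \<le> n"
  then have "1 / real (card (level T n)) \<le> 1 / real (card (level T (scale \<alpha>)))"
    using card_level_mono card_level_pos by (intro divide_left_mono) auto
  with * show "1 / real (card (level T n)) \<le> \<alpha>" by simp
next
  assume "1 / real (card (level T n)) \<le> \<alpha>"
  then show "scale \<alpha> \<le> n" unfolding scale_def by (rule Least_le)
qed

text \<open>One level before the scale, the cardinality is still below \<open>1 / \<alpha>\<close>,
  while it is at least a power of two.\<close>

lemma scale_le_log:
  assumes "0 < \<alpha>" "\<alpha> < 1" shows "real (scale \<alpha>) \<le> 1 + log 2 (1 / \<alpha>)"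
proof (cases "scale \<alpha>")
  case 0
  then show ?thesis using assms by simp
next
  case (Suc n)
  then have "\<not> scale \<alpha> \<le> n" by simp
  then have "\<alpha> < 1 / real (card (level T n))" using assms by (simp add: scale_le_iff)
  then have "real (card (level T n)) < 1 / \<alpha>" using card_level_pos[of n] assms by (simp add: field_simps)
  moreover have "2 ^ n \<le> real (card (level T n))"
    using card_level_ge_power2[of n] by (metis of_nat_le_iff of_nat_numeral of_nat_power)
  ultimately have "(2::real) ^ n < 1 / \<alpha>" by linarith
  then have "2 powr n < 1 / \<alpha>" by (simp add: powr_realpow)
  then have "real n \<le> log 2 (1 / \<alpha>)" using assms by (simp add: le_log_iff)
  then show ?thesis using Suc by simp
qed

lemma tree_dist_le_iff:
  assumes "0 < \<alpha>" shows "tree_dist T f g \<le> \<alpha> \<longleftrightarrow> restr f (scale \<alpha>) = restr g (scale \<alpha>)"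
proof (cases "f = g")
  case True
  then show ?thesis using assms by (simp add: tree_dist_def)
next
  case False
  then have dist: "tree_dist T f g = 1 / real (card (level T (GREATEST n. restr f n = restr g n)))"
    by (simp add: tree_dist_def)
  show ?thesis
    unfolding dist scale_le_iff[OF assms, symmetric]
    by (rule restr_eq_iff_le_Greatest[OF False, symmetric])
qed

lemma tree_dist_le_1: "tree_dist T f g \<le> 1"
proof -
  have "1 / real (card (level T n)) \<le> 1" for n using card_level_pos[of n] by simp
  then show ?thesis unfolding tree_dist_def by simp
qed

text \<open>Choose a path of \<open>S\<close> through each node of the level: no two of them fit
  into one set of diameter at most \<open>\<alpha>\<close>. Conversely, the cylinders of these nodes
  form a cover.\<close>

lemma covering_number_paths:
  assumes "leafless_tree S" "S \<subseteq> T" "0 < \<alpha>"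
  shows "covering_number (paths T) (tree_dist T) \<alpha> (paths S) = card (level S (scale \<alpha>))"
    (is "_ = card ?L")
proof -
  interpret S: leafless_tree S by fact
  let ?cover = "\<lambda>\<A> k. finite \<A> \<and> card \<A> = k \<and> paths S \<subseteq> \<Union>\<A> \<and>
    (\<forall>A\<in>\<A>. A \<subseteq> paths T \<and> diam (tree_dist T) A \<le> \<alpha>)"
  have lower: "card ?L \<le> card \<A>" if "?cover \<A> k" for \<A> k
  proof -
    have "\<exists>f. f \<in> paths S \<and> restr f (scale \<alpha>) = \<sigma>" if "\<sigma> \<in> ?L" for \<sigma>
      using that S.path_through_node[of \<sigma>] by (auto simp: level_def)
    then obtain f where f: "\<And>\<sigma>. \<sigma> \<in> ?L \<Longrightarrow> f \<sigma> \<in> paths S \<and> restr (f \<sigma>) (scale \<alpha>) = \<sigma>" by metis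
    then have "\<forall>\<sigma>\<in>?L. \<exists>A\<in>\<A>. f \<sigma> \<in> A" using that by blast
    then obtain A where A: "\<And>\<sigma>. \<sigma> \<in> ?L \<Longrightarrow> A \<sigma> \<in> \<A> \<and> f \<sigma> \<in> A \<sigma>" by metis
    have "inj_on A ?L"
    proof (rule inj_onI)
      fix \<sigma> \<tau> assume st: "\<sigma> \<in> ?L" "\<tau> \<in> ?L" "A \<sigma> = A \<tau>"
      have "(f \<sigma>, f \<tau>) \<in> A \<sigma> \<times> A \<sigma>" using A st by auto
      \<comment> \<open>Distances are at most 1, so the supremum is over a bounded set and dominates
        each distance.\<close>
      then have "tree_dist T (f \<sigma>) (f \<tau>) \<le> (SUP (x, y)\<in>A \<sigma> \<times> A \<sigma>. tree_dist T x y)"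
        using tree_dist_le_1 by (intro cSUP_upper2[where x = "(f \<sigma>, f \<tau>)"]) (auto intro!: bdd_aboveI[of _ 1])
      also have "\<dots> = diam (tree_dist T) (A \<sigma>)" using A[OF st(1)] by (auto simp: diam_def)
      also have "\<dots> \<le> \<alpha>" using that A[OF st(1)] by auto
      finally have "restr (f \<sigma>) (scale \<alpha>) = restr (f \<tau>) (scale \<alpha>)" using assms tree_dist_le_iff by simp
      then show "\<sigma> = \<tau>" using f st by metis
    qed
    then show ?thesis using that A by (intro card_inj_on_le[of A]) auto
  qed
  let ?C = "cylinder T ` ?L"
  have diam: "diam (tree_dist T) (cylinder T \<sigma>) \<le> \<alpha>" if "\<sigma> \<in> ?L" for \<sigma>
  proof (cases "cylinder T \<sigma> = {}")
    case True
    then show ?thesis using assms by (simp add: diam_def)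
  next
    case False
    have "tree_dist T f g \<le> \<alpha>" if "f \<in> cylinder T \<sigma>" "g \<in> cylinder T \<sigma>" for f g
      using that \<open>\<sigma> \<in> ?L\<close> assms tree_dist_le_iff by (auto simp: cylinder_def level_def)
    then have "(SUP (x, y)\<in>cylinder T \<sigma> \<times> cylinder T \<sigma>. tree_dist T x y) \<le> \<alpha>"
      using False by (intro cSUP_least) auto
    then show ?thesis using False by (simp add: diam_def)
  qed
  have "paths S \<subseteq> \<Union>?C"
  proof
    fix f assume f: "f \<in> paths S"
    then have "f \<in> cylinder T (restr f (scale \<alpha>))"
      using assms(2) by (auto simp: cylinder_def paths_def)
    with f show "f \<in> \<Union>?C" using restr_in_level by blast
  qed
  then have C: "?cover ?C (card ?C)"
    using diam S.finite_level by (auto simp: cylinder_def)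
  \<comment> \<open>Since covers exist, the least cardinality is attained by some cover, to which
    \<open>lower\<close> applies.\<close>
  then have "\<exists>k \<A>. ?cover \<A> k" by (intro exI)
  then have "\<exists>\<A>. ?cover \<A> (LEAST k. \<exists>\<A>. ?cover \<A> k)" by (rule LeastI_ex)
  then obtain \<B> where cov: "?cover \<B> (covering_number (paths T) (tree_dist T) \<alpha> (paths S))"
    unfolding covering_number_def by (rule exE)
  have "covering_number (paths T) (tree_dist T) \<alpha> (paths S) \<le> card ?C"
    unfolding covering_number_def by (rule Least_le, rule exI, rule C)
  also have "\<dots> \<le> card ?L" using S.finite_level by (rule card_image_le)
  finally show ?thesis using cov lower[OF cov] by (intro antisym) simp_all
qed

end

section \<open>The uniform measure of cylinders\<close>

lemma (in leafless_tree) card_level_Suc_uniform: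
  assumes "levelwise_uniformly_branching S" "\<sigma> \<in> level S n"
  shows "card (level S (Suc n)) = card (level S n) * card (successors S \<sigma>)"
proof -
  have "card (successors S \<tau>) = card (successors S \<sigma>)" if "\<tau> \<in> level S n" for \<tau>
    using assms that unfolding levelwise_uniformly_branching_def by blast
  then have "(\<Sum>\<tau>\<in>level S n. card (successors S \<tau>)) = (\<Sum>\<tau>\<in>level S n. card (successors S \<sigma>))"
    by (rule sum.cong[OF refl])
  then show ?thesis unfolding card_level_Suc by simp
qed

text \<open>A cylinder is the trace on the paths of a finite intersection of open sets, each fixing
  one coordinate.\<close>

lemma cylinder_in_sets:
  assumes "uniform_tree_measure S \<mu>" shows "cylinder S \<sigma> \<in> sets \<mu>"
proof -
  have "open {f :: nat \<Rightarrow> nat. f i = c}" for i c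
  proof -
    have "continuous_on UNIV (\<lambda>f :: nat \<Rightarrow> nat. f i)" by (rule continuous_on_product_coordinates)
    then have "open ((\<lambda>f :: nat \<Rightarrow> nat. f i) -` {c})"
      by (rule open_vimage[rotated]) (rule discrete_topology_class.open_discrete)
    then show ?thesis by (simp add: vimage_def)
  qed
  then have "open (\<Inter>i\<in>{..<length \<sigma>}. {f :: nat \<Rightarrow> nat. f i = \<sigma> ! i})" by (intro open_INT) auto
  moreover have "cylinder S \<sigma> = paths S \<inter> (\<Inter>i\<in>{..<length \<sigma>}. {f. f i = \<sigma> ! i})"
    by (auto simp: cylinder_def restr_eq_conv)
  ultimately show ?thesis
    using assms by (auto simp: uniform_tree_measure_def sets_restrict_space)
qed

text \<open>From one level to the next, the measure is divided by the common branching number, and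
  the cardinality of the level is multiplied by it.\<close>

lemma (in leafless_tree) measure_cylinder:
  assumes "uniform_tree_measure S \<mu>" "levelwise_uniformly_branching S"
  shows "\<sigma> \<in> level S n \<Longrightarrow> measure \<mu> (cylinder S \<sigma>) = 1 / real (card (level S n))"
proof (induction n arbitrary: \<sigma>)
  case 0
  interpret prob_space \<mu> using assms(1) by (simp add: uniform_tree_measure_def)
  have "sets \<mu> = sets (restrict_space borel (paths S))" using assms(1) by (simp add: uniform_tree_measure_def)
  from sets_eq_imp_space_eq[OF this] have "space \<mu> = paths S" by (simp add: space_restrict_space)
  moreover have "cylinder S [] = paths S" by (auto simp: cylinder_def restr_def)
  ultimately show ?case using 0 prob_space by (simp add: level_0)
next
  case (Suc n)
  then obtain \<tau> where \<tau>: "\<tau> \<in> level S n" "\<sigma> \<in> successors S \<tau>" unfolding level_Suc by blast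
  then have "measure \<mu> (cylinder S \<sigma>) = measure \<mu> (cylinder S \<tau>) / real (card (successors S \<tau>))"
    using assms(1) by (auto simp: uniform_tree_measure_def level_def)
  then show ?case
    using Suc.IH[OF \<tau>(1)] card_level_Suc_uniform[OF assms(2) \<tau>(1)] by simp
qed


section \<open>Comparison of the dimensions\<close>

lemma Liminf_le_of_vanishing_error:
  fixes F G e :: "'a \<Rightarrow> real"
  assumes le: "eventually (\<lambda>x. F x \<le> G x + e x) net" and e: "(e \<longlongrightarrow> 0) net"
  shows "Liminf net (\<lambda>x. ereal (F x)) \<le> Liminf net (\<lambda>x. ereal (G x))"
  unfolding le_Liminf_iff
proof (intro allI impI)
  fix y assume "y < Liminf net (\<lambda>x. ereal (F x))"
  \<comment> \<open>Two reals \<open>a < b\<close> are put between \<open>y\<close> and the limit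
    inferior of \<open>F\<close>: eventually \<open>F\<close> exceeds \<open>b\<close> and the error
    is below \<open>b - a\<close>, so \<open>G\<close> exceeds \<open>a\<close>.\<close>
  then obtain b where b: "y < ereal b" "ereal b < Liminf net (\<lambda>x. ereal (F x))"
    using ereal_dense2 by blast
  obtain a where a: "y < ereal a" "ereal a < ereal b" using ereal_dense2[OF b(1)] by blast
  have "eventually (\<lambda>x. ereal b < ereal (F x)) net" using b(2) by (rule less_LiminfD)
  moreover have "eventually (\<lambda>x. e x < b - a) net" using e a(2) by (intro order_tendstoD(2)[OF e]) simp
  ultimately show "eventually (\<lambda>x. y < ereal (G x)) net"
    using le
  proof eventually_elim
    case (elim x)
    then have "a < G x" by simp
    then show ?case using a(1) by (meson less_ereal.simps(1) less_trans)
  qed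
qed

lemma Limsup_le_of_vanishing_error:
  fixes F G e :: "'a \<Rightarrow> real"
  assumes le: "eventually (\<lambda>x. F x \<le> G x + e x) net" and e: "(e \<longlongrightarrow> 0) net"
  shows "Limsup net (\<lambda>x. ereal (F x)) \<le> Limsup net (\<lambda>x. ereal (G x))"
proof -
  \<comment> \<open>Negation exchanges the two limits as well as the roles of \<open>F\<close> and
    \<open>G\<close>.\<close>
  have "eventually (\<lambda>x. - G x \<le> - F x + e x) net" using le by eventually_elim simp
  from Liminf_le_of_vanishing_error[OF this e] show ?thesis
    by (simp add: ereal_Liminf_uminus flip: uminus_ereal.simps)
qed

lemma (in doubling_tree) dimension_le_of_log_error:
  fixes A B :: "real \<Rightarrow> real"
  assumes "\<And>\<alpha>. 0 < \<alpha> \<Longrightarrow> \<alpha> < 1 \<Longrightarrow> A \<alpha> \<le> B \<alpha> + c + 2 * log 2 (real (scale \<alpha>) + 2)"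
  shows "Liminf (at_right 0) (\<lambda>\<alpha>. ereal (A \<alpha> / log 2 (1 / \<alpha>))) \<le>
         Liminf (at_right 0) (\<lambda>\<alpha>. ereal (B \<alpha> / log 2 (1 / \<alpha>)))"
    and "Limsup (at_right 0) (\<lambda>\<alpha>. ereal (A \<alpha> / log 2 (1 / \<alpha>))) \<le>
         Limsup (at_right 0) (\<lambda>\<alpha>. ereal (B \<alpha> / log 2 (1 / \<alpha>)))"
proof -
  \<comment> \<open>By \<open>scale_le_log\<close>, \<open>scale \<alpha> + 2\<close> is at most
    \<open>log 2 (1 / \<alpha>) + 3\<close>; the error is thus doubly logarithmic in
    \<open>1 / \<alpha>\<close>.\<close>
  let ?e = "\<lambda>\<alpha>::real. (c + 2 * log 2 (log 2 (1 / \<alpha>) + 3)) / log 2 (1 / \<alpha>)"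
  have e: "(?e \<longlongrightarrow> 0) (at_right 0)" by real_asymp
  have "eventually (\<lambda>\<alpha>::real. 0 < \<alpha> \<and> \<alpha> < 1) (at_right 0)"
    unfolding eventually_at_right_field by (intro exI[of _ 1]) auto
  then have le: "eventually (\<lambda>\<alpha>. A \<alpha> / log 2 (1 / \<alpha>) \<le> B \<alpha> / log 2 (1 / \<alpha>) + ?e \<alpha>) (at_right 0)"
  proof eventually_elim
    case (elim \<alpha>)
    then have L: "0 < log 2 (1 / \<alpha>)" by simp
    have "log 2 (real (scale \<alpha>) + 2) \<le> log 2 (log 2 (1 / \<alpha>) + 3)"
      using scale_le_log[of \<alpha>] elim by (intro log_mono) auto
    then have "A \<alpha> \<le> B \<alpha> + (c + 2 * log 2 (log 2 (1 / \<alpha>) + 3))"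
      using assms[of \<alpha>] elim by linarith
    from divide_right_mono[OF this less_imp_le[OF L]] show ?case by (simp only: add_divide_distrib)
  qed
  from Liminf_le_of_vanishing_error[OF le e] Limsup_le_of_vanishing_error[OF le e]
  show "Liminf (at_right 0) (\<lambda>\<alpha>. ereal (A \<alpha> / log 2 (1 / \<alpha>))) \<le>
         Liminf (at_right 0) (\<lambda>\<alpha>. ereal (B \<alpha> / log 2 (1 / \<alpha>)))"
    and "Limsup (at_right 0) (\<lambda>\<alpha>. ereal (A \<alpha> / log 2 (1 / \<alpha>))) \<le>
         Limsup (at_right 0) (\<lambda>\<alpha>. ereal (B \<alpha> / log 2 (1 / \<alpha>)))" .
qed

section \<open>Programs attaining the complexity at a given scale\<close>

lemma optimal_machine_surj:
  assumes "optimal_machine U" shows "\<exists>p. U p = Some u"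
proof -
  \<comment> \<open>The optimal machine simulates the identity machine, which outputs every
    string.\<close>
  have "partial_computable (Some :: bool list \<rightharpoonup> bool list)"
    using computable_id[where ?'a = "bool list"] by (simp add: computable_def)
  then show ?thesis using assms unfolding optimal_machine_def by blast
qed

lemma (in doubling_tree) approx_complexity_le:
  assumes "0 < \<alpha>" "restr (r u) (scale \<alpha>) = restr f (scale \<alpha>)" "U q = Some u"
  shows "approx_complexity U (tree_dist T) r \<alpha> f \<le> length q"
proof -
  have "approx_complexity U (tree_dist T) r \<alpha> f \<le> point_complexity U r (r u)"
    unfolding approx_complexity_def
    using assms tree_dist_le_iff by (intro Least_le bexI[of _ "r u"]) auto
  also have "\<dots> \<le> plain_complexity U u"
    unfolding point_complexity_def by (intro Least_le) blast
  also have "\<dots> \<le> length q"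
    unfolding plain_complexity_def using assms by (intro Least_le) blast
  finally show ?thesis .
qed

text \<open>The point \<open>r v\<close> in the ball and a program for each string make all three
  nested minima range over nonempty sets, so they are attained.\<close>

lemma (in doubling_tree) approx_complexity_attained:
  assumes "0 < \<alpha>" "restr (r v) (scale \<alpha>) = restr f (scale \<alpha>)" "optimal_machine U"
  obtains u p where "restr (r u) (scale \<alpha>) = restr f (scale \<alpha>)" "U p = Some u"
    "length p = approx_complexity U (tree_dist T) r \<alpha> f"
proof -
  have "\<exists>k. \<exists>w\<in>range r. tree_dist T f w \<le> \<alpha> \<and> point_complexity U r w = k"
    using assms tree_dist_le_iff by (intro exI bexI[of _ "r v"] conjI refl) auto
  from LeastI_ex[OF this] obtain w where w: "w \<in> range r" "tree_dist T f w \<le> \<alpha>"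
    "point_complexity U r w = approx_complexity U (tree_dist T) r \<alpha> f"
    unfolding approx_complexity_def by blast
  have "\<exists>k u. r u = w \<and> plain_complexity U u = k" using w(1) by blast
  from LeastI_ex[OF this] obtain u where u: "r u = w" "plain_complexity U u = point_complexity U r w"
    unfolding point_complexity_def by blast
  have "\<exists>k p. U p = Some u \<and> length p = k" using optimal_machine_surj[OF assms(3)] by blast
  from LeastI_ex[OF this] obtain p where p: "U p = Some u" "length p = plain_complexity U u"
    unfolding plain_complexity_def by blast
  show thesis
    using w u p assms(1) tree_dist_le_iff by (intro that[of u p]) auto
qed


section \<open>The upper bound\<close>

text \<open>This makes the search for the \<open>N\<close>-th node of \<open>S\<close> in
  \<open>short_programs\<close> total.\<close>

lemma infinite_nth_element:
  fixes A :: "nat set"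
  assumes "infinite A" shows "\<exists>K\<in>A. card {k. k < K \<and> k \<in> A} = N"
proof (induction N)
  case 0
  have "\<exists>k. k \<in> A" using assms by (cases "A = {}") auto
  then obtain K where K: "K \<in> A" "\<forall>k<K. k \<notin> A"
    using exists_least_iff[of "\<lambda>k. k \<in> A"] by blast
  then have "{k. k < K \<and> k \<in> A} = {}" by blast
  then have "card {k. k < K \<and> k \<in> A} = 0" by (simp only: card.empty)
  with K(1) show ?case by blast
next
  case (Suc N)
  then obtain K where K: "K \<in> A" "card {k. k < K \<and> k \<in> A} = N" by blast
  define K' where "K' = (LEAST k. k \<in> A \<and> K < k)"
  have "\<exists>k. k \<in> A \<and> K < k" using assms unfolding infinite_nat_iff_unbounded by blast
  then have K': "K' \<in> A" "K < K'" unfolding K'_def using LeastI_ex[of "\<lambda>k. k \<in> A \<and> K < k"] by auto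
  have "\<not> (k \<in> A \<and> K < k)" if "k < K'" for k using that unfolding K'_def by (rule not_less_Least)
  then have "{k. k < K' \<and> k \<in> A} = insert K {k. k < K \<and> k \<in> A}"
    using K K' by (auto; metis linorder_neqE_nat)
  then show ?case using K K' by (intro bexI[of _ K']) simp
qed

lemma card_less_strict_mono:
  fixes K L :: nat
  assumes "K \<in> A" "K < L" shows "card {k. k < K \<and> k \<in> A} < card {k. k < L \<and> k \<in> A}"
proof (rule psubset_card_mono)
  show "{k. k < K \<and> k \<in> A} \<subset> {k. k < L \<and> k \<in> A}" using assms by auto
qed auto

locale represented_tree = doubling_tree T + S: leafless_tree S for T S :: "nat list set" +
  fixes U :: "bool list \<rightharpoonup> bool list" and h :: "bool list \<Rightarrow> nat list"
    and r :: "bool list \<Rightarrow> nat \<Rightarrow> nat"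
  assumes optimal: "optimal_machine U" and iso: "lenlex_iso h T" and computable_h: "computable h"
    and rep: "path_representation T h r" and S_subset: "S \<subseteq> T" and computable_S: "computable_set S"
begin

text \<open>Lists \<open>T\<close> by natural numbers in length-lexicographical order, so that
  search and counting can run over numbers.\<close>

definition node :: "nat \<Rightarrow> nat list" where
  "node k = h (nth_string k)"

definition S_indices :: "nat set" where
  "S_indices = {k. node k \<in> S}"

lemma bij_h: "bij_betw h UNIV T"
  using iso by (simp add: lenlex_iso_def)

lemma inj_node: "inj node"
  by (rule injI) (metis node_def bij_h bij_betw_imp_inj_on injD string_index_nth)

lemma node_index: "node (string_index u) = h u"
  by (simp add: node_def)

lemma node_surj: assumes "\<sigma> \<in> T" obtains u where "h u = \<sigma>" "node (string_index u) = \<sigma>"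
proof -
  obtain u where "h u = \<sigma>" using assms bij_h by (metis bij_betw_imp_surj_on imageE)
  then show thesis using that node_index by blast
qed

text \<open>A shorter node precedes a longer one in the order, and \<open>h\<close> reflects the
  order.\<close>

lemma length_node_mono: "k \<le> l \<Longrightarrow> length (node k) \<le> length (node l)"
proof (rule ccontr)
  assume kl: "k \<le> l" "\<not> length (node k) \<le> length (node l)"
  then have "(h (nth_string l), h (nth_string k)) \<in> lenlex {(x, y). x < y}"
    by (simp add: lenlex_conv node_def)
  then have "(nth_string l, nth_string k) \<in> lenlex {(x, y). x < y}"
    using iso unfolding lenlex_iso_def by blast
  from string_index_strict_mono[OF this] kl(1) show False by simp
qed

lemma infinite_S_indices: "infinite S_indices"
proof
  assume fin: "finite S_indices"
  have "\<exists>\<sigma>. \<sigma> \<in> level S n" for n using S.card_level_pos[of n] by (metis card.empty ex_in_conv less_irrefl)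
  then obtain \<sigma> where \<sigma>: "\<And>n. \<sigma> n \<in> level S n" by metis
  have "\<exists>k\<in>S_indices. length (node k) = n" for n
  proof -
    obtain u where "node (string_index u) = \<sigma> n"
      using node_surj[of "\<sigma> n"] \<sigma>[of n] S_subset by (auto simp: level_def)
    then show ?thesis using \<sigma>[of n] by (intro bexI[of _ "string_index u"]) (auto simp: level_def S_indices_def)
  qed
  then have "(\<lambda>k. length (node k)) ` S_indices = UNIV" by (auto simp: image_iff) metis
  with finite_imageI[OF fin, of "\<lambda>k. length (node k)"] show False by simp
qed

lemma computable_node: "computable a \<Longrightarrow> computable (\<lambda>x. node (a x))"
  unfolding node_def by (intro computable_compose[OF computable_h] computable_nth_string)

lemma computable_in_S: "computable a \<Longrightarrow> computable (\<lambda>x. a x \<in> S)"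
  using computable_compose[of "\<lambda>a. a \<in> S" a] computable_S by (simp add: computable_set_def)

text \<open>Nodes listed up to \<open>K\<close> have length at most \<open>n\<close>, and each of
  these \<open>n + 1\<close> levels of \<open>S\<close> has at most as many nodes as level
  \<open>n\<close>.\<close>

lemma card_S_indices_le:
  assumes "node K \<in> level S n"
  shows "Suc (card {k. k < K \<and> k \<in> S_indices}) \<le> (n + 1) * card (level S n)"
proof -
  let ?A = "insert K {k. k < K \<and> k \<in> S_indices}"
  have "Suc (card {k. k < K \<and> k \<in> S_indices}) = card ?A" by simp
  also have "\<dots> = card (node ` ?A)" by (rule card_image[OF inj_on_subset[OF inj_node subset_UNIV], symmetric])
  also have "\<dots> \<le> card (\<Union>j\<in>{..n}. level S j)"
  proof (rule card_mono)
    show "node ` ?A \<subseteq> (\<Union>j\<in>{..n}. level S j)"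
    proof
      fix \<sigma> assume "\<sigma> \<in> node ` ?A"
      then obtain k where k: "k \<in> ?A" "\<sigma> = node k" by blast
      then have "length \<sigma> \<le> n" "\<sigma> \<in> S"
        using length_node_mono[of k K] assms by (auto simp: S_indices_def level_def)
      then show "\<sigma> \<in> (\<Union>j\<in>{..n}. level S j)" by (auto simp: level_def)
    qed
  qed (use S.finite_level in auto)
  also have "\<dots> \<le> (\<Sum>j\<le>n. card (level S j))" by (rule card_UN_le) simp
  also have "\<dots> \<le> (\<Sum>j\<le>n. card (level S n))" by (intro sum_mono S.card_level_mono) simp
  finally show ?thesis by simp
qed

text \<open>The \<open>N\<close>-th binary string is a program for the \<open>N\<close>-th node of \<open>S\<close>. As the nodes are listed by
  length and the levels grow, the index of a node of length \<open>n\<close> is less than \<open>(n + 1) |S\<^sub>n|\<close>.\<close>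

lemma short_programs:
  "\<exists>c. \<forall>f\<in>paths S. \<forall>n. \<exists>u q. U q = Some u \<and> restr (r u) n = restr f n \<and>
    real (length q) \<le> log 2 (real (card (level S n))) + log 2 (real n + 1) + real (c :: nat)"
proof -
  \<comment> \<open>The index of the \<open>N\<close>-th node of \<open>S\<close> is recognised by
    counting its predecessors, which is decidable.\<close>
  define P where "P p K \<longleftrightarrow> K \<in> S_indices \<and> card {k. k < K \<and> k \<in> S_indices} = string_index p" for p K
  define V where "V p = nth_string (LEAST K. P p K)" for p
  have "computable V"
    unfolding V_def
  proof (intro computable_nth_string computable_Least)
    show "computable (\<lambda>x. P (fst x) (snd x))"
      unfolding P_def S_indices_def mem_Collect_eq
      by (intro computable_intros computable_in_S computable_node computable_card_less computable_string_index)
    show "\<exists>K. P p K" for p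
      using infinite_nth_element[OF infinite_S_indices] unfolding P_def by blast
  qed
  then have "partial_computable (\<lambda>p. Some (V p))" by (simp add: computable_def)
  then obtain c where c: "\<And>p u. Some (V p) = Some u \<Longrightarrow> \<exists>q. U q = Some u \<and> length q \<le> length p + c"
    using optimal unfolding optimal_machine_def by meson
  show ?thesis
  proof (intro exI[of _ c] ballI allI)
    fix f n assume f: "f \<in> paths S"
    then have \<sigma>: "restr f n \<in> level S n" by (rule restr_in_level)
    then obtain u where u: "h u = restr f n" "node (string_index u) = restr f n"
      using node_surj S_subset by (auto simp: level_def)
    define K where "K = string_index u"
    have K: "K \<in> S_indices" using u \<sigma> by (simp add: K_def S_indices_def level_def)
    define p where "p = nth_string (card {k. k < K \<and> k \<in> S_indices})"
    have "(LEAST K. P p K) = K"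
    proof (rule Least_equality)
      show "P p K" using K by (simp add: P_def p_def)
      show "K \<le> L" if "P p L" for L
        using that card_less_strict_mono[of L S_indices K] by (auto simp: P_def p_def not_less[symmetric])
    qed
    then have "V p = u" by (simp add: V_def K_def)
    with c[of p u] obtain q where q: "U q = Some u" "length q \<le> length p + c" by auto
    \<comment> \<open>The index of \<open>p\<close> is the number of nodes of \<open>S\<close>
      listed before \<open>K\<close>; the \<open>Suc\<close> in both bounds is the same.\<close>
    have "2 ^ length p \<le> (n + 1) * card (level S n)"
      using string_index_bounds(1)[of p] card_S_indices_le[of K n] u \<sigma> by (simp add: p_def K_def)
    then have "real (2 ^ length p) \<le> real ((n + 1) * card (level S n))" by (rule of_nat_mono)
    then have "2 powr real (length p) \<le> (real n + 1) * real (card (level S n))"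
      by (simp add: powr_realpow algebra_simps)
    moreover have pos: "0 < real (card (level S n))" using S.card_level_pos by simp
    ultimately have "real (length p) \<le> log 2 ((real n + 1) * real (card (level S n)))"
      by (simp add: le_log_iff)
    also have "\<dots> = log 2 (real (card (level S n))) + log 2 (real n + 1)"
      using pos by (simp add: log_mult)
    finally have "real (length q) \<le> log 2 (real (card (level S n))) + log 2 (real n + 1) + real c"
      using q(2) by linarith
    moreover have "restr (r u) n = restr f n"
      using rep u(1) unfolding path_representation_def by (metis length_restr)
    ultimately show "\<exists>u q. U q = Some u \<and> restr (r u) n = restr f n \<and>
        real (length q) \<le> log 2 (real (card (level S n))) + log 2 (real n + 1) + real c"
      using q(1) by blast
  qed
qed

end


section \<open>The lower bound for random paths\<close>

lemma sums_inverse_consecutive: "(\<lambda>n. 1 / ((real n + 1) * (real n + 2))) sums 1"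
proof -
  have "(\<lambda>n. 1 / (real n + 1)) \<longlonglongrightarrow> 0" by real_asymp
  from telescope_sums'[OF this]
  have "(\<lambda>n. 1 / (real n + 1) - 1 / (real (Suc n) + 1)) sums 1" by simp
  moreover have "1 / (real n + 1) - 1 / (real (Suc n) + 1) = 1 / ((real n + 1) * (real n + 2))" for n
    by (simp add: field_simps)
  ultimately show ?thesis by simp
qed

context represented_tree
begin

text \<open>A lower bound on the size of a level is confirmed by finding enough of its nodes in an
  initial part of the list. This existential form makes the set \<open>compressible\<close>
  c.e.\<close>

lemma card_level_ge_iff:
  "c \<le> card (level S n) \<longleftrightarrow> (\<exists>K. c \<le> card {k. k < K \<and> node k \<in> S \<and> length (node k) = n})"
proof
  assume c: "c \<le> card (level S n)"
  have "\<exists>k. node k = \<sigma>" if "\<sigma> \<in> level S n" for \<sigma>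
    using that S_subset node_surj[of \<sigma>] by (auto simp: level_def)
  then obtain i where i: "\<And>\<sigma>. \<sigma> \<in> level S n \<Longrightarrow> node (i \<sigma>) = \<sigma>" by metis
  define K where "K = Suc (Max (i ` level S n))"
  have "i ` level S n \<subseteq> {k. k < K \<and> node k \<in> S \<and> length (node k) = n}"
    using i S.finite_level by (auto simp: K_def level_def less_Suc_eq_le)
  then have "card (i ` level S n) \<le> card {k. k < K \<and> node k \<in> S \<and> length (node k) = n}"
    by (intro card_mono) auto
  moreover have "card (i ` level S n) = card (level S n)"
    using i by (intro card_image inj_onI) metis
  ultimately show "\<exists>K. c \<le> card {k. k < K \<and> node k \<in> S \<and> length (node k) = n}" using c by (intro exI[of _ K]) linarith
next
  assume "\<exists>K. c \<le> card {k. k < K \<and> node k \<in> S \<and> length (node k) = n}"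
  then obtain K where "c \<le> card {k. k < K \<and> node k \<in> S \<and> length (node k) = n}" by blast
  also have "\<dots> = card (node ` {k. k < K \<and> node k \<in> S \<and> length (node k) = n})"
    by (rule card_image[OF inj_on_subset[OF inj_node subset_UNIV], symmetric])
  also have "\<dots> \<le> card (level S n)"
    by (intro card_mono S.finite_level) (auto simp: level_def)
  finally show "c \<le> card (level S n)" .
qed

text \<open>The reciprocals sum over \<open>n\<close> to \<open>1 / 2 ^ m\<close>, the bound for the
  \<open>m\<close>-th test set.\<close>

definition weight :: "nat \<Rightarrow> nat \<Rightarrow> nat" where
  "weight m n = (n + 1) * (n + 2) * 2 ^ m"

text \<open>The inequality says that program number \<open>k\<close> is among the first
  \<open>card (level S n) div weight m n\<close>; multiplied out, it avoids division.\<close>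

definition compressible :: "(nat \<times> nat list) set" where
  "compressible = {(m, \<sigma>). \<exists>k u. U (nth_string k) = Some u \<and> restr (r u) (length \<sigma>) = \<sigma> \<and>
     (k + 1) * weight m (length \<sigma>) \<le> card (level S (length \<sigma>))}"

lemma ce_compressible: "ce_set compressible"
proof -
  have "partial_computable U" using optimal by (simp add: optimal_machine_def)
  then obtain G :: "bool list \<Rightarrow> nat \<Rightarrow> nat" where G: "computable (\<lambda>p. G (fst p) (snd p))"
    and U: "\<forall>p u. U p = Some u \<longleftrightarrow> (\<exists>t. G p t = Suc (enc u))"
    using partial_computable_stages by blast
  have comp_G: "computable (\<lambda>x. G (a x) (b x))" if "computable a" "computable b"
    for a :: "(nat \<times> nat list) \<times> nat \<Rightarrow> bool list" and b
    using computable_compose[OF G computable_Pair[OF that]] by simp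
  have comp_enc: "computable (\<lambda>x. enc (a x))" if "computable a"
    for a :: "(nat \<times> nat list) \<times> nat \<Rightarrow> bool list"
    using that by (simp only: computable_enc_iff)
  have comp_r: "computable (\<lambda>x. r (a x) (b x))" if "computable a" "computable b"
    for a :: "((nat \<times> nat list) \<times> nat) \<times> nat \<Rightarrow> bool list" and b
    using computable_compose2[of r a b] rep that by (simp add: path_representation_def)
  \<comment> \<open>Here \<open>l\<close> indexes the output string, \<open>t\<close> is a stage at
    which program \<open>k\<close> has halted, and \<open>K\<close> bounds the part of the list in
    which nodes are counted. With these fixed, all is decidable.\<close>
  define Q where "Q m \<sigma> k l t K \<longleftrightarrow> G (nth_string k) t = Suc (enc (nth_string l)) \<and>
      (\<forall>i<length \<sigma>. r (nth_string l) i = nth0 \<sigma> i) \<and>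
      (k + 1) * ((length \<sigma> + 1) * (length \<sigma> + 2) * 2 ^ m) \<le>
        card {j. j < K \<and> node j \<in> S \<and> length (node j) = length \<sigma>}" for m \<sigma> k l t K
  \<comment> \<open>One number codes the four witnesses, as \<open>ce_set_Ex\<close> treats a single
    quantifier.\<close>
  define P where "P x z \<longleftrightarrow> Q (fst x) (snd x) (fst (prod_decode z)) (fst (prod_decode (snd (prod_decode z))))
      (fst (prod_decode (snd (prod_decode (snd (prod_decode z))))))
      (snd (prod_decode (snd (prod_decode (snd (prod_decode z))))))" for x z
  have "computable (\<lambda>x. P (fst x) (snd x))"
    unfolding P_def Q_def
    by (intro computable_intros comp_G comp_enc comp_r computable_ball_less computable_card_less
        computable_node computable_in_S computable_nth_string)
  then have "ce_set {x. \<exists>z. P x z}" by (rule ce_set_Ex)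
  moreover have "(\<exists>z. P (m, \<sigma>) z) \<longleftrightarrow> (m, \<sigma>) \<in> compressible" for m \<sigma>
  proof -
    have "(\<exists>z. P (m, \<sigma>) z) \<longleftrightarrow> (\<exists>k l t K. Q m \<sigma> k l t K)"
    proof
      assume "\<exists>k l t K. Q m \<sigma> k l t K"
      then obtain k l t K where "Q m \<sigma> k l t K" by blast
      then have "P (m, \<sigma>) (prod_encode (k, prod_encode (l, prod_encode (t, K))))" by (simp add: P_def)
      then show "\<exists>z. P (m, \<sigma>) z" ..
    qed (auto simp: P_def)
    also have "\<dots> \<longleftrightarrow> (\<exists>k u t. G (nth_string k) t = Suc (enc u) \<and> restr (r u) (length \<sigma>) = \<sigma> \<and>
        (k + 1) * weight m (length \<sigma>) \<le> card (level S (length \<sigma>)))"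
      (is "?lhs \<longleftrightarrow> ?rhs")
    proof
      assume ?lhs
      then show ?rhs
        unfolding Q_def card_level_ge_iff weight_def restr_eq_conv nth0_def by (fastforce simp del: mult_Suc mult_Suc_right)
    next
      assume ?rhs
      then obtain k u t where "G (nth_string k) t = Suc (enc u)" "restr (r u) (length \<sigma>) = \<sigma>"
        "(k + 1) * weight m (length \<sigma>) \<le> card (level S (length \<sigma>))" by blast
      moreover from this obtain K where "(k + 1) * weight m (length \<sigma>) \<le>
          card {j. j < K \<and> node j \<in> S \<and> length (node j) = length \<sigma>}"
        unfolding card_level_ge_iff by blast
      ultimately have "Q m \<sigma> k (string_index u) t K"
        unfolding Q_def weight_def[symmetric] restr_eq_conv nth0_def by simp
      then show ?lhs by blast
    qed
    also have "\<dots> \<longleftrightarrow> (m, \<sigma>) \<in> compressible" unfolding compressible_def using U by auto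
    finally show ?thesis .
  qed
  then have "{x. \<exists>z. P x z} = compressible" by auto
  ultimately show ?thesis by simp
qed

lemma card_compressible_le:
  "card {\<sigma> \<in> level S n. (m, \<sigma>) \<in> compressible} * weight m n \<le> card (level S n)"
proof -
  let ?N = "card (level S n) div weight m n"
  \<comment> \<open>Each program gives at most one node of length \<open>n\<close>. Programs that do
    not halt add unspecified strings on the right, which is harmless for an upper bound.\<close>
  have "{\<sigma> \<in> level S n. (m, \<sigma>) \<in> compressible} \<subseteq> (\<lambda>k. restr (r (the (U (nth_string k)))) n) ` {..<?N}"
  proof
    fix \<sigma> assume "\<sigma> \<in> {\<sigma> \<in> level S n. (m, \<sigma>) \<in> compressible}"
    then obtain k u where *: "U (nth_string k) = Some u" "restr (r u) n = \<sigma>"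
      "(k + 1) * weight m n \<le> card (level S n)"
      by (auto simp: compressible_def level_def)
    have "0 < weight m n" by (simp add: weight_def)
    with *(3) have "k + 1 \<le> ?N" by (simp only: less_eq_div_iff_mult_less_eq)
    then have "k < ?N" by simp
    with * show "\<sigma> \<in> (\<lambda>k. restr (r (the (U (nth_string k)))) n) ` {..<?N}" by force
  qed
  from surj_card_le[OF _ this] have "card {\<sigma> \<in> level S n. (m, \<sigma>) \<in> compressible} \<le> ?N" by simp
  then show ?thesis by (meson div_times_less_eq_dividend mult_le_mono1 order_trans)
qed

text \<open>On level \<open>n\<close>, the compressible nodes have total measure at most
  \<open>1 / weight m n\<close>, as all nodes of a level have equal measure; the sum over the levels
  telescopes.\<close>

lemma ml_test_compressible:
  assumes \<mu>: "uniform_tree_measure S \<mu>" and unif: "levelwise_uniformly_branching S"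
  shows "ml_test S \<mu> (\<lambda>m. \<Union>\<sigma>\<in>{\<sigma>. (m, \<sigma>) \<in> compressible}. cylinder S \<sigma>)"
  unfolding ml_test_def
proof (intro conjI allI)
  show "uniformly_Sigma1 S (\<lambda>m. \<Union>\<sigma>\<in>{\<sigma>. (m, \<sigma>) \<in> compressible}. cylinder S \<sigma>)"
    unfolding uniformly_Sigma1_def using ce_compressible by blast
next
  fix m
  interpret prob_space \<mu> using \<mu> by (simp add: uniform_tree_measure_def)
  define B where "B n = {\<sigma> \<in> level S n. (m, \<sigma>) \<in> compressible}" for n
  define A where "A n = (\<Union>\<sigma>\<in>B n. cylinder S \<sigma>)" for n
  have fin: "finite (B n)" for n using S.finite_level by (simp add: B_def)
  have A: "A n \<in> sets \<mu>" for n
    unfolding A_def using fin cylinder_in_sets[OF \<mu>] by (intro sets.finite_UN) auto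
  have bound: "measure \<mu> (A n) \<le> 1 / ((real n + 1) * (real n + 2)) * (1 / 2 ^ m)" for n
  proof -
    have s: "0 < real (card (level S n))" using S.card_level_pos by simp
    have w: "real (weight m n) = (real n + 1) * (real n + 2) * 2 ^ m"
      by (simp add: weight_def algebra_simps)
    have "measure \<mu> (A n) \<le> (\<Sum>\<sigma>\<in>B n. measure \<mu> (cylinder S \<sigma>))"
      unfolding A_def using fin cylinder_in_sets[OF \<mu>] by (intro finite_measure_subadditive_finite) auto
    also have "\<dots> = (\<Sum>\<sigma>\<in>B n. 1 / real (card (level S n)))"
      using S.measure_cylinder[OF \<mu> unif] by (intro sum.cong) (auto simp: B_def)
    also have "\<dots> = real (card (B n)) / real (card (level S n))" by simp
    also have "\<dots> \<le> 1 / real (weight m n)"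
    proof -
      have "real (card (B n)) * real (weight m n) \<le> real (card (level S n))"
        using card_compressible_le[of n m] unfolding B_def by (metis of_nat_le_iff of_nat_mult)
      moreover have "0 < real (weight m n)" unfolding w by (intro mult_pos_pos) auto
      ultimately show ?thesis using s by (simp add: divide_le_eq pos_le_divide_eq)
    qed
    finally show ?thesis unfolding w by (simp add: mult_ac)
  qed
  have sums: "(\<lambda>n. 1 / ((real n + 1) * (real n + 2)) * (1 / 2 ^ m)) sums (1 * (1 / 2 ^ m))"
    by (intro sums_mult2 sums_inverse_consecutive)
  have summable: "summable (\<lambda>n. measure \<mu> (A n))"
    by (rule summable_comparison_test'[OF sums_summable[OF sums], of 0]) (use bound in auto)
  \<comment> \<open>Strings outside \<open>S\<close> may be compressible too, but their cylinders
    are empty.\<close>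
  have "cylinder S \<sigma> = {}" if "\<sigma> \<notin> S" for \<sigma>
    using that by (auto simp: cylinder_def paths_def) metis
  then have "(\<Union>\<sigma>\<in>{\<sigma>. (m, \<sigma>) \<in> compressible}. cylinder S \<sigma>) = (\<Union>n. A n)"
    unfolding A_def B_def level_def by blast
  also have "measure \<mu> (\<Union>n. A n) \<le> (\<Sum>n. measure \<mu> (A n))"
    using A summable by (intro finite_measure_subadditive_countably) auto
  also have "\<dots> \<le> (\<Sum>n. 1 / ((real n + 1) * (real n + 2)) * (1 / 2 ^ m))"
    by (intro suminf_le bound summable sums_summable[OF sums])
  also have "\<dots> = 1 / 2 ^ m" by (simp only: sums_unique[OF sums, symmetric] mult_1_left)
  finally show "measure \<mu> (\<Union>\<sigma>\<in>{\<sigma>. (m, \<sigma>) \<in> compressible}. cylinder S \<sigma>) \<le> 1 / 2 ^ m" .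
qed

text \<open>A random path avoids some test set, and the index of this set is a constant valid for
  all \<open>n\<close> simultaneously.\<close>

lemma random_incompressible:
  assumes "uniform_tree_measure S \<mu>" "levelwise_uniformly_branching S" "ml_random S \<mu> f"
  obtains m where "\<And>n u p. U p = Some u \<Longrightarrow> restr (r u) n = restr f n \<Longrightarrow>
    log 2 (real (card (level S n))) \<le> real (length p) + real m + 2 * log 2 (real n + 2)"
proof -
  have f: "f \<in> paths S" using assms(3) by (simp add: ml_random_def)
  obtain m where m: "f \<notin> (\<Union>\<sigma>\<in>{\<sigma>. (m, \<sigma>) \<in> compressible}. cylinder S \<sigma>)"
    using assms(3) ml_test_compressible[OF assms(1,2)] unfolding ml_random_def by blast
  show thesis
  \<comment> \<open>The additional 1 is the logarithm of the factor 2 in the bound on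
    \<open>string_index p\<close>.\<close>
  proof (rule that[of "m + 1"])
    fix n u p assume u: "U p = Some u" "restr (r u) n = restr f n"
    have "f \<in> cylinder S (restr f n)" using f by (simp add: cylinder_def)
    with m have "(m, restr f n) \<notin> compressible" by blast
    then have "card (level S n) < (string_index p + 1) * weight m n"
      using u unfolding compressible_def by (auto simp: not_le dest!: spec[of _ "string_index p"])
    also have "\<dots> \<le> (2 * 2 ^ length p) * ((n + 2) * (n + 2) * 2 ^ m)"
      unfolding weight_def using string_index_bounds(2)[of p] by (intro mult_le_mono) auto
    finally have "real (card (level S n)) \<le> real ((2 * 2 ^ length p) * ((n + 2) * (n + 2) * 2 ^ m))"
      by (simp only: of_nat_le_iff less_imp_le)
    also have "\<dots> = 2 ^ (length p + (m + 1)) * (real n + 2) ^ 2"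
      by (simp add: power_add power2_eq_square algebra_simps)
    finally have "log 2 (real (card (level S n))) \<le> log 2 (2 ^ (length p + (m + 1)) * (real n + 2) ^ 2)"
      using S.card_level_pos by (intro log_mono) auto
    also have "\<dots> = real (length p) + real (m + 1) + 2 * log 2 (real n + 2)"
      by (simp add: log_mult log_nat_power)
    finally show "log 2 (real (card (level S n))) \<le> real (length p) + real (m + 1) + 2 * log 2 (real n + 2)" .
  qed
qed

lemma dimensions_le_box_dims:
  assumes f: "f \<in> paths S"
  shows "alg_dim U (tree_dist T) r f \<le> lower_box_dim (paths T) (tree_dist T) (paths S)"
    and "strong_alg_dim U (tree_dist T) r f \<le> upper_box_dim (paths T) (tree_dist T) (paths S)"
proof -
  obtain c :: nat where c: "\<forall>f\<in>paths S. \<forall>n. \<exists>u q. U q = Some u \<and> restr (r u) n = restr f n \<and>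
      real (length q) \<le> log 2 (real (card (level S n))) + log 2 (real n + 1) + real c"
    using short_programs by blast
  have *: "real (approx_complexity U (tree_dist T) r \<alpha> f) \<le>
      log 2 (real (covering_number (paths T) (tree_dist T) \<alpha> (paths S))) + real c
        + 2 * log 2 (real (scale \<alpha>) + 2)"
    if "0 < \<alpha>" for \<alpha>
  proof -
    obtain u q where uq: "U q = Some u" "restr (r u) (scale \<alpha>) = restr f (scale \<alpha>)"
      "real (length q) \<le> log 2 (real (card (level S (scale \<alpha>)))) + log 2 (real (scale \<alpha>) + 1) + real c"
      using c f by blast
    have "real (approx_complexity U (tree_dist T) r \<alpha> f) \<le> real (length q)"
      using approx_complexity_le[where r = r and U = U, OF that uq(2,1)] by simp
    \<comment> \<open>Weakened to the error term of \<open>dimension_le_of_log_error\<close>, which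
      serves both directions.\<close>
    moreover have "log 2 (real (scale \<alpha>) + 1) \<le> 2 * log 2 (real (scale \<alpha>) + 2)"
    proof -
      have "log 2 (real (scale \<alpha>) + 1) \<le> log 2 (real (scale \<alpha>) + 2)" by (intro log_mono) auto
      moreover have "0 \<le> log 2 (real (scale \<alpha>) + 2)" by simp
      ultimately show ?thesis by linarith
    qed
    ultimately show ?thesis
      using uq(3) unfolding covering_number_paths[OF S.leafless_tree_axioms S_subset that] by linarith
  qed
  show "alg_dim U (tree_dist T) r f \<le> lower_box_dim (paths T) (tree_dist T) (paths S)"
    unfolding alg_dim_def lower_box_dim_def by (rule dimension_le_of_log_error(1)[where c = "real c"]) (rule *)
  show "strong_alg_dim U (tree_dist T) r f \<le> upper_box_dim (paths T) (tree_dist T) (paths S)"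
    unfolding strong_alg_dim_def upper_box_dim_def by (rule dimension_le_of_log_error(2)[where c = "real c"]) (rule *)
qed

lemma box_dims_le_dimensions:
  assumes "uniform_tree_measure S \<mu>" "levelwise_uniformly_branching S" "ml_random S \<mu> f"
  shows "lower_box_dim (paths T) (tree_dist T) (paths S) \<le> alg_dim U (tree_dist T) r f"
    and "upper_box_dim (paths T) (tree_dist T) (paths S) \<le> strong_alg_dim U (tree_dist T) r f"
proof -
  have f: "f \<in> paths S" using assms(3) by (simp add: ml_random_def)
  obtain m where m: "\<And>n u p. U p = Some u \<Longrightarrow> restr (r u) n = restr f n \<Longrightarrow>
      log 2 (real (card (level S n))) \<le> real (length p) + real m + 2 * log 2 (real n + 2)"
    using random_incompressible[OF assms] by blast
  have *: "log 2 (real (covering_number (paths T) (tree_dist T) \<alpha> (paths S))) \<le>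
      real (approx_complexity U (tree_dist T) r \<alpha> f) + real m + 2 * log 2 (real (scale \<alpha>) + 2)"
    if "0 < \<alpha>" for \<alpha>
  proof -
    \<comment> \<open>Some \<open>r v\<close> has to lie in the ball for the complexity to be
      attained; \<open>r\<close> applied to the string of this node does.\<close>
    have "restr f (scale \<alpha>) \<in> T" using f S_subset by (auto simp: paths_def)
    then obtain v where "h v = restr f (scale \<alpha>)" using node_surj by blast
    then have "restr (r v) (scale \<alpha>) = restr f (scale \<alpha>)"
      using rep unfolding path_representation_def by (metis length_restr)
    from approx_complexity_attained[where r = r, OF that this optimal] obtain u p where
      "restr (r u) (scale \<alpha>) = restr f (scale \<alpha>)" "U p = Some u"
      "length p = approx_complexity U (tree_dist T) r \<alpha> f" .
    then show ?thesis
      using m[of p u "scale \<alpha>"] unfolding covering_number_paths[OF S.leafless_tree_axioms S_subset that]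
      by simp
  qed
  show "lower_box_dim (paths T) (tree_dist T) (paths S) \<le> alg_dim U (tree_dist T) r f"
    unfolding alg_dim_def lower_box_dim_def by (rule dimension_le_of_log_error(1)[where c = "real m"]) (rule *)
  show "upper_box_dim (paths T) (tree_dist T) (paths S) \<le> strong_alg_dim U (tree_dist T) r f"
    unfolding strong_alg_dim_def upper_box_dim_def by (rule dimension_le_of_log_error(2)[where c = "real m"]) (rule *)
qed

end

theorem proposition6p1:
  fixes T S :: "nat list set"
    and U :: "bool list \<rightharpoonup> bool list"
    and h :: "bool list \<Rightarrow> nat list"
    and r :: "bool list \<Rightarrow> nat \<Rightarrow> nat"
  assumes "optimal_machine U"
    and "is_tree T" and "computable_set T" and "finitely_branching T"
    and "\<forall>\<sigma>\<in>T. card (successors T \<sigma>) \<ge> 2"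
    and "lenlex_iso h T" and "computable h"
    and "path_representation T h r"
    and "is_tree S" and "S \<subseteq> T" and "computable_set S" and "\<not> (\<exists>\<sigma>. leaf S \<sigma>)"
  shows "(\<forall>f\<in>paths S.
            alg_dim U (tree_dist T) r f \<le> lower_box_dim (paths T) (tree_dist T) (paths S) \<and>
            strong_alg_dim U (tree_dist T) r f \<le> upper_box_dim (paths T) (tree_dist T) (paths S)) \<and>
         (levelwise_uniformly_branching S \<longrightarrow>
            (\<forall>\<mu> f. uniform_tree_measure S \<mu> \<and> ml_random S \<mu> f \<longrightarrow>
               alg_dim U (tree_dist T) r f = lower_box_dim (paths T) (tree_dist T) (paths S) \<and>
               strong_alg_dim U (tree_dist T) r f = upper_box_dim (paths T) (tree_dist T) (paths S)))"
proof -
  have "finitely_branching S"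
    unfolding finitely_branching_def
  proof
    fix \<sigma> assume "\<sigma> \<in> S"
    moreover have "successors S \<sigma> \<subseteq> successors T \<sigma>" using assms(10) by (auto simp: successors_def)
    ultimately show "finite (successors S \<sigma>)"
      using assms(4,10) unfolding finitely_branching_def by (blast intro: finite_subset)
  qed
  then interpret represented_tree T S U h r
    using assms by unfold_locales auto
  \<comment> \<open>Random paths are paths of \<open>S\<close>, so the inequalities of the first
    part apply to them and antisymmetry yields equality.\<close>
  have "f \<in> paths S" if "ml_random S \<mu> f" for \<mu> f using that by (simp add: ml_random_def)
  then show ?thesis
    using dimensions_le_box_dims box_dims_le_dimensions by (blast intro: antisym)
qed

end
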